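(* Let $m\ge 2$ and $\delta_m=(m-1,m-2,\dots,1)$, and let $H_{\delta_m}=1^{m-1}3^{m-2}5^{m-3}\cdots(2m-3)$ be the product of the hook lengths of $\delta_m$. If $m=2k$ then $$\mathrm{alt}(\delta_m)=\mathrm{ralt}(\delta_m)=\frac{E^k\prod_{j=1}^{m-2}(E^2+j^2)^{k-\lceil j/2\rceil}}{H_{\delta_m}}.$$ If $m=2k+1$ then $$\mathrm{alt}(\delta_m)=\mathrm{ralt}(\delta_m)=\frac{E^k\prod_{j=1}^{m-2}(E^2+j^2)^{k-\lfloor j/2\rfloor}}{H_{\delta_m}}.$$ Here the right-hand sides are evaluated umbrally.
   Context: For a standard Young tableau $T$ with $n$ entries, its descent set is $D(T)=\{i: i+1\text{ appears in a lower row than } i\}$; $T$ is alternating if $D(T)=\{1,3,5,\dots\}\cap[n-1]$ and reverse alternating if $D(T)=\{2,4,6,\dots\}\cap[n-1]$. $\mathrm{alt}(\lambda)$ and $\mathrm{ralt}(\lambda)$ are the numbers of alternating and reverse alternating SYT of shape $\lambda$. Euler numbers $E_n$: $\sum_{n\ge0}E_nx^n/n!=\sec x+\tan x$. Umbral evaluation: expand the polynomial in the indeterminate $E$ in powers of $E$, then replace each $E^k$ by $E_k$ as the last step. *)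

theory Defs
  imports Complex_Main "HOL-Library.FuncSet" "HOL-Computational_Algebra.Computational_Algebra"
begin

text \<open>
  A partition is the list of its parts in weakly decreasing order. Cells are pairs (row, column),
  both counted from 0, with row 0 at the top (English notation), so that a \<^emph>\<open>lower\<close> row is one
  with a larger row index.
\<close>

definition young_diagram :: "nat list \<Rightarrow> (nat \<times> nat) set" where
  "young_diagram lam = {(i, j). i < length lam \<and> j < lam ! i}"

text \<open>
  Tableaux are extensional functions (\<open>undefined\<close> outside the diagram), so that each
  tableau is represented by exactly one function and cardinalities count tableaux.
\<close>

definition standard_tableaux :: "nat list \<Rightarrow> (nat \<times> nat \<Rightarrow> nat) set" where
  "standard_tableaux lam =
     {T \<in> extensional (young_diagram lam).
        bij_betw T (young_diagram lam) {1..sum_list lam} \<and>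
        (\<forall>i j j'. (i, j) \<in> young_diagram lam \<and> (i, j') \<in> young_diagram lam \<and> j < j'
           \<longrightarrow> T (i, j) < T (i, j')) \<and>
        (\<forall>i i' j. (i, j) \<in> young_diagram lam \<and> (i', j) \<in> young_diagram lam \<and> i < i'
           \<longrightarrow> T (i, j) < T (i', j))}"

definition descent_set :: "nat list \<Rightarrow> (nat \<times> nat \<Rightarrow> nat) \<Rightarrow> nat set" where
  "descent_set lam T =
     {a. \<exists>i j i' j'. (i, j) \<in> young_diagram lam \<and> (i', j') \<in> young_diagram lam \<and>
           T (i, j) = a \<and> T (i', j') = a + 1 \<and> i < i'}"

definition alternating :: "nat list \<Rightarrow> (nat \<times> nat \<Rightarrow> nat) \<Rightarrow> bool" where
  "alternating lam T \<longleftrightarrow> descent_set lam T = {a. odd a} \<inter> {1..sum_list lam - 1}"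

definition reverse_alternating :: "nat list \<Rightarrow> (nat \<times> nat \<Rightarrow> nat) \<Rightarrow> bool" where
  "reverse_alternating lam T \<longleftrightarrow> descent_set lam T = {a. even a} \<inter> {1..sum_list lam - 1}"

definition alt :: "nat list \<Rightarrow> nat" where
  "alt lam = card {T \<in> standard_tableaux lam. alternating lam T}"

definition ralt :: "nat list \<Rightarrow> nat" where
  "ralt lam = card {T \<in> standard_tableaux lam. reverse_alternating lam T}"

definition staircase :: "nat \<Rightarrow> nat list" where
  "staircase m = rev [1..<m]"

definition hook :: "nat list \<Rightarrow> nat \<times> nat \<Rightarrow> (nat \<times> nat) set" where
  "hook lam c = {(i, j) \<in> young_diagram lam.
     (i = fst c \<and> snd c \<le> j) \<or> (j = snd c \<and> fst c \<le> i)}"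

definition hook_product :: "nat list \<Rightarrow> nat" where
  "hook_product lam = (\<Prod>c\<in>young_diagram lam. card (hook lam c))"

definition euler_number :: "nat \<Rightarrow> real" where
  "euler_number n = fact n * fps_nth (inverse (fps_cos 1) + fps_tan 1) n"

text \<open>
  Umbral evaluation is performed on a fully expanded polynomial in the indeterminate \<open>E\<close>; the
  polynomial \<open>umbral_E\<close> is that indeterminate.
\<close>

definition umbral_eval :: "real poly \<Rightarrow> real" where
  "umbral_eval p = (\<Sum>i\<le>degree p. coeff p i * euler_number i)"

abbreviation umbral_E :: "real poly" where
  "umbral_E \<equiv> [:0, 1:]"

end

theory Submission
  imports Defs "Jordan_Normal_Form.Determinant"
begin

text \<open>
  Reading off the row of each entry turns standard tableaux into ballot words, and runs without
  descents into horizontal strips. Telescoping over the length of the final run shows that the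
  numbers of tableaux with descent set \<open>{n - 2, n - 4, \<dots>}\<close>, taken with the sign
  \<open>(-1)^\<lfloor>n/2\<rfloor>\<close>, satisfy a recursion: their sum over all \<open>\<mu>\<close> such that \<open>\<lambda>/\<mu>\<close>
  is a horizontal strip of even size is 1 if \<open>\<lambda>\<close> is a single row of odd size and 0 for every other
  nonempty \<open>\<lambda>\<close>.

  The Jacobi--Trudi determinants of \<open>H\<^sub>a(u) = (1 + z)^(a + u/2) (1 - z)^(a - u/2)\<close> satisfy the same
  recursion after the umbral substitution \<open>u^k \<mapsto> (-1)^\<lfloor>k/2\<rfloor> E\<^sub>k\<close>. Indeed
  \<open>H\<^sub>a(u) = H\<^bsub>a - 1/2\<^esub>(u + 1) (1 - z) = H\<^bsub>a - 1/2\<^esub>(u - 1) (1 + z)\<close>, summing over all ways to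
  remove a horizontal strip divides the generating function by \<open>1 - z\<close>, and
  \<open>(sec x + tan x) cos x = 1 + sin x\<close> says that \<open>f(u + 1) + f(u - 1)\<close> evaluates to
  \<open>2 f(0) + f(1) - f(-1)\<close>. Here \<open>a = 1/2\<close> for even and \<open>a = 0\<close> for odd size.

  For a staircase, multiplying the generating function by an even power series is a unitriangular
  row operation, so \<open>H\<^sub>a(u)\<close> may be replaced by \<open>(1 + z)^u\<close>. The resulting binomial determinant is
  the product of \<open>u + c\<close> over all contents \<open>c\<close>, divided by the product of the hook lengths.
  Transposition complements descent sets, hence \<open>alt = ralt\<close> for the self-conjugate staircase.
\<close>

section \<open>Jacobi--Trudi determinants\<close>

lemma det_mat_unitriangular_left:
  fixes a f g :: "nat \<Rightarrow> nat \<Rightarrow> 'a :: idom"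
  assumes "\<And>i j. i < N \<Longrightarrow> j < N \<Longrightarrow> g i j = (\<Sum>k<N. a i k * f k j)"
    and "\<And>i. a i i = 1" and "\<And>i k. k < i \<Longrightarrow> a i k = 0"
  shows "det (mat N N (\<lambda>(i, j). g i j)) = det (mat N N (\<lambda>(i, j). f i j))"
proof -
  let ?A = "mat N N (\<lambda>(i, j). a i j)" and ?F = "mat N N (\<lambda>(i, j). f i j)"
  have "mat N N (\<lambda>(i, j). g i j) = ?A * ?F"
    by (rule eq_matI) (auto simp: assms(1) scalar_prod_def lessThan_atLeast0)
  moreover have "det (?A * ?F) = det ?A * det ?F"
    by (rule det_mult) auto
  moreover have "det ?A = prod_list (diag_mat ?A)"
    by (rule det_upper_triangular[of _ N]) (auto simp: upper_triangular_def assms)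
  moreover have "prod_list (diag_mat ?A) = 1"
    by (simp add: prod_list_diag_prod assms)
  ultimately show ?thesis by simp
qed

lemma det_mat_unitriangular_right:
  fixes a f g :: "nat \<Rightarrow> nat \<Rightarrow> 'a :: idom"
  assumes "\<And>i j. i < N \<Longrightarrow> j < N \<Longrightarrow> g i j = (\<Sum>k<N. f i k * a k j)"
    and "\<And>i. a i i = 1" and "\<And>i k. k < i \<Longrightarrow> a i k = 0"
  shows "det (mat N N (\<lambda>(i, j). g i j)) = det (mat N N (\<lambda>(i, j). f i j))"
proof -
  let ?A = "mat N N (\<lambda>(i, j). a i j)" and ?F = "mat N N (\<lambda>(i, j). f i j)"
  have "mat N N (\<lambda>(i, j). g i j) = ?F * ?A"
    by (rule eq_matI) (auto simp: assms(1) scalar_prod_def lessThan_atLeast0)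
  moreover have "det (?F * ?A) = det ?F * det ?A"
    by (rule det_mult) auto
  moreover have "det ?A = prod_list (diag_mat ?A)"
    by (rule det_upper_triangular[of _ N]) (auto simp: upper_triangular_def assms)
  moreover have "prod_list (diag_mat ?A) = 1"
    by (simp add: prod_list_diag_prod assms)
  ultimately show ?thesis by simp
qed

lemma det_mat_leibniz:
  "det (mat N N (\<lambda>(i, j). f i j)) =
     (\<Sum>p\<in>{p. p permutes {0..<N}}. signof p * (\<Prod>i=0..<N. f i (p i)))"
proof -
  have "det (mat N N (\<lambda>(i, j). f i j)) =
     (\<Sum>p\<in>{p. p permutes {0..<N}}. signof p * (\<Prod>i=0..<N. mat N N (\<lambda>(i, j). f i j) $$ (i, p i)))"
    by (rule det_def') auto
  also have "\<dots> = (\<Sum>p\<in>{p. p permutes {0..<N}}. signof p * (\<Prod>i=0..<N. f i (p i)))"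
    by (intro sum.cong refl arg_cong2[of _ _ _ _ "(*)"] prod.cong)
       (auto simp: permutes_in_image[of _ "{0..<N}", simplified] dest: permutes_in_image)
  finally show ?thesis .
qed

section \<open>Specialized Schur functions and branching over horizontal strips\<close>

definition fps_nth_int :: "real fps \<Rightarrow> int \<Rightarrow> real" where
  "fps_nth_int F n = (if n < 0 then 0 else fps_nth F (nat n))"

text \<open>For \<open>F\<close> with constant term 1 this is the Schur function of
  \<open>lam\<close> under the specialization sending the complete homogeneous functions
  \<open>h_n\<close> to the coefficients of \<open>F\<close>, with \<open>h_n = 0\<close> for
  negative \<open>n\<close>.\<close>

definition jacobi_trudi :: "nat \<Rightarrow> (nat \<Rightarrow> nat) \<Rightarrow> real fps \<Rightarrow> real" where
  "jacobi_trudi N lam F =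
     det (mat N N (\<lambda>(i, j). fps_nth_int F (int (lam i) - int i + int j)))"

text \<open>A partition with at most \<open>N\<close> parts is a function vanishing from \<open>N\<close> on; then
  \<open>mu \<in> interlacing lam\<close> says that \<open>lam/mu\<close> is a horizontal strip.\<close>

definition interlacing :: "(nat \<Rightarrow> nat) \<Rightarrow> (nat \<Rightarrow> nat) set" where
  "interlacing lam = {mu. \<forall>i. lam (Suc i) \<le> mu i \<and> mu i \<le> lam i}"

definition partitions_upto :: "nat \<Rightarrow> (nat \<Rightarrow> nat) set" where
  "partitions_upto N = {lam. (\<forall>i. lam (Suc i) \<le> lam i) \<and> (\<forall>i\<ge>N. lam i = 0)}"

text \<open>The parts of \<open>mu\<close> vary independently over intervals, so a product of sums
  over these intervals is a sum over \<open>interlacing lam\<close>.\<close>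

lemma bij_betw_interlacing:
  assumes "\<And>i. i \<ge> N \<Longrightarrow> lam i = 0"
  shows "bij_betw (\<lambda>mu. restrict mu {0..<N}) (interlacing lam)
           (Pi\<^sub>E {0..<N} (\<lambda>i. {lam (Suc i)..lam i}))"
proof (rule bij_betw_byWitness[where f' = "\<lambda>f i. if i < N then f i else 0"])
  show "\<forall>a\<in>interlacing lam. (\<lambda>i. if i < N then restrict a {0..<N} i else 0) = a"
  proof
    fix a assume "a \<in> interlacing lam"
    then have "a i = 0" if "\<not> i < N" for i
      using that assms[of i] unfolding interlacing_def by (metis (mono_tags) le_0_eq mem_Collect_eq not_le)
    then show "(\<lambda>i. if i < N then restrict a {0..<N} i else 0) = a" by auto
  qed
qed (use assms in \<open>auto simp: interlacing_def PiE_def extensional_def Pi_def fun_eq_iff\<close>)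

lemma finite_interlacing:
  assumes "lam \<in> partitions_upto N"
  shows "finite (interlacing lam)"
proof -
  have "finite (Pi\<^sub>E {0..<N} (\<lambda>i. {lam (Suc i)..lam i}))"
    by (intro finite_PiE) auto
  moreover have "\<And>i. i \<ge> N \<Longrightarrow> lam i = 0" using assms by (simp add: partitions_upto_def)
  ultimately show ?thesis
    using bij_betw_finite[OF bij_betw_interlacing[of N lam]] by blast
qed

lemma interlacing_partitions_upto:
  assumes "lam \<in> partitions_upto N" "mu \<in> interlacing lam"
  shows "mu \<in> partitions_upto N"
  using assms by (auto simp: partitions_upto_def interlacing_def) (meson le_trans, metis le_0_eq)

lemma fps_nth_int_mult_one_minus_X:
  "fps_nth_int (F * (1 - fps_X)) n = fps_nth_int F n - fps_nth_int F (n - 1)"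
proof -
  have "fps_nth_int (F * (1 - fps_X)) (int k) = fps_nth_int F (int k) - fps_nth_int F (int k - 1)" for k
    by (cases k) (auto simp: fps_nth_int_def right_diff_distrib nat_add_distrib)
  from this[of "nat n"] show ?thesis
    by (cases "n < 0") (auto simp: fps_nth_int_def)
qed

lemma sum_fps_nth_int_telescope:
  "a \<le> Suc b \<Longrightarrow> (\<Sum>x=a..b. fps_nth_int (F * (1 - fps_X)) (int x + c)) =
     fps_nth_int F (int b + c) - fps_nth_int F (int a - 1 + c)"
proof (induction b)
  case 0
  then show ?case by (cases "a = 0") (auto simp: fps_nth_int_mult_one_minus_X le_Suc_eq)
next
  case (Suc b)
  show ?case
  proof (cases "a \<le> Suc b")
    case True
    then have "{a..Suc b} = insert (Suc b) {a..b}" by auto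
    then show ?thesis using Suc.IH True
      by (simp add: fps_nth_int_mult_one_minus_X)
  next
    case False
    then have "a = Suc (Suc b)" using Suc.prems by simp
    then show ?thesis by (simp add: algebra_simps)
  qed
qed

text \<open>The branching rule of Schur functions, with one variable equal to 1 split off.
  Subtracting from each row the next one telescopes every entry into a sum of coefficients of
  \<open>F * (1 - fps_X)\<close>, and multilinearity in the rows expands the determinant.\<close>

lemma jacobi_trudi_interlacing_sum:
  assumes lam: "lam \<in> partitions_upto N"
  shows "jacobi_trudi N lam F = (\<Sum>mu\<in>interlacing lam. jacobi_trudi N mu (F * (1 - fps_X)))"
proof -
  let ?G = "F * (1 - fps_X)"
  let ?f = "\<lambda>i j. fps_nth_int F (int (lam i) - int i + int j)"
  let ?a = "\<lambda>i k. if k = i then 1 else if k = Suc i then -1 else (0::real)"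
  let ?r = "\<lambda>i j x. fps_nth_int ?G (int x - int i + int j)"
  let ?g = "\<lambda>i j. \<Sum>x=lam (Suc i)..lam i. ?r i j x"
  have dec: "lam (Suc i) \<le> lam i" and zero: "i \<ge> N \<Longrightarrow> lam i = 0" for i
    using lam by (auto simp: partitions_upto_def)
  \<comment> \<open>The lower end contributes the index \<open>lam (Suc i) - 1 - i + j\<close>,
    which is that of row \<open>Suc i\<close>.\<close>
  have tel: "?g i j = ?f i j - ?f (Suc i) j" for i j
    using sum_fps_nth_int_telescope[of "lam (Suc i)" "lam i" F "int j - int i"] dec[of i]
    by (simp add: algebra_simps)
  have "?g i j = (\<Sum>k<N. ?a i k * ?f k j)" if "i < N" "j < N" for i j
  proof -
    have "(\<Sum>k<N. ?a i k * ?f k j) =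
        (\<Sum>k<N. (if k = i then ?f k j else 0) - (if k = Suc i then ?f k j else 0))"
      by (intro sum.cong) auto
    also have "\<dots> = ?f i j - (if Suc i < N then ?f (Suc i) j else 0)"
      using that by (simp add: sum_subtractf sum.delta)
    \<comment> \<open>For the last row the subtracted row \<open>N\<close> is zero, as its indices
      \<open>j - N\<close> are negative.\<close>
    also have "(if Suc i < N then ?f (Suc i) j else 0) = ?f (Suc i) j"
      using that zero[of "Suc i"] by (auto simp: fps_nth_int_def)
    finally show ?thesis using tel by simp
  qed
  then have "det (mat N N (\<lambda>(i, j). ?g i j)) = det (mat N N (\<lambda>(i, j). ?f i j))"
    by (rule det_mat_unitriangular_left[where a = ?a]) auto
  then have "jacobi_trudi N lam F =
      (\<Sum>p\<in>{p. p permutes {0..<N}}. signof p * (\<Prod>i=0..<N. ?g i (p i)))"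
    unfolding jacobi_trudi_def by (simp add: det_mat_leibniz)
  also have "\<dots> = (\<Sum>p\<in>{p. p permutes {0..<N}}. signof p *
      (\<Sum>mu\<in>Pi\<^sub>E {0..<N} (\<lambda>i. {lam (Suc i)..lam i}). \<Prod>i=0..<N. ?r i (p i) (mu i)))"
    by (subst prod_sum_PiE) auto
  also have "\<dots> = (\<Sum>p\<in>{p. p permutes {0..<N}}. signof p *
      (\<Sum>mu\<in>interlacing lam. \<Prod>i=0..<N. ?r i (p i) (mu i)))"
    by (subst sum.reindex_bij_betw[OF bij_betw_interlacing[of N lam], symmetric]) (auto intro: zero)
  also have "\<dots> = (\<Sum>mu\<in>interlacing lam. \<Sum>p\<in>{p. p permutes {0..<N}}. signof p *
       (\<Prod>i=0..<N. ?r i (p i) (mu i)))"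
    unfolding sum_distrib_left by (rule sum.swap)
  also have "\<dots> = (\<Sum>mu\<in>interlacing lam. jacobi_trudi N mu ?G)"
    unfolding jacobi_trudi_def det_mat_leibniz ..
  finally show ?thesis .
qed

section \<open>The substitution of -z for z and strips of even size\<close>

definition fps_flip :: "real fps \<Rightarrow> real fps" where
  "fps_flip F = Abs_fps (\<lambda>n. (-1) ^ n * fps_nth F n)"

lemma fps_flip_eq_compose: "fps_flip F = fps_compose F (- fps_X)"
  by (rule fps_ext) (simp add: fps_flip_def fps_compose_uminus')

lemma fps_flip_mult: "fps_flip (F * G) = fps_flip F * fps_flip G"
  by (simp add: fps_flip_eq_compose fps_compose_mult_distrib)

lemma fps_flip_flip [simp]: "fps_flip (fps_flip F) = F"
  by (rule fps_ext) (simp add: fps_flip_def flip: power_mult_distrib mult.assoc)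

lemma fps_flip_one_plus_X: "fps_flip (1 + fps_X) = 1 - fps_X"
  by (rule fps_ext) (auto simp: fps_flip_def fps_X_def)

lemma fps_nth_int_flip: "fps_nth_int (fps_flip F) n = (-1) powi n * fps_nth_int F n"
  by (auto simp: fps_nth_int_def fps_flip_def power_int_def)

text \<open>The determinant is homogeneous: in every Leibniz term the shifts
  \<open>- i + p i\<close> cancel, so the indices add up to the size of \<open>lam\<close>.\<close>

lemma jacobi_trudi_flip:
  "jacobi_trudi N lam (fps_flip F) = (-1) ^ (\<Sum>i<N. lam i) * jacobi_trudi N lam F"
proof -
  let ?n = "\<lambda>p i. int (lam i) - int i + int (p i)"
  have pw: "(\<Prod>i=0..<N. (-1::real) powi f i) = (-1) powi (\<Sum>i=0..<N. f i)" for f :: "nat \<Rightarrow> int"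
    by (induction N) (auto simp: power_int_add)
  have "(\<Prod>i=0..<N. fps_nth_int (fps_flip F) (?n p i)) =
        (-1) ^ (\<Sum>i<N. lam i) * (\<Prod>i=0..<N. fps_nth_int F (?n p i))"
    if "p permutes {0..<N}" for p
  proof -
    have "(\<Sum>i=0..<N. int (p i)) = (\<Sum>i=0..<N. int i)"
      using sum.permute[OF that, of int] by (simp add: comp_def)
    then have "(\<Sum>i=0..<N. ?n p i) = int (\<Sum>i<N. lam i)"
      by (simp add: sum.distrib sum_subtractf lessThan_atLeast0)
    then show ?thesis
      by (simp add: fps_nth_int_flip prod.distrib pw del: of_nat_sum)
  qed
  then show ?thesis
    unfolding jacobi_trudi_def det_mat_leibniz sum_distrib_left
    by (intro sum.cong) auto
qed

text \<open>Branching applied to \<open>F1\<close> sums over all strips; applied to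
  \<open>fps_flip F2\<close> it weights each strip by the sign of its size. The mean keeps the
  strips of even size.\<close>

lemma jacobi_trudi_even_interlacing_sum:
  assumes lam: "lam \<in> partitions_upto N"
    and F: "F1 * (1 - fps_X) = F" "F2 * (1 + fps_X) = F"
  shows "(\<Sum>mu | mu \<in> interlacing lam \<and> even (\<Sum>i<N. lam i + mu i). jacobi_trudi N mu F) =
           (jacobi_trudi N lam F1 + jacobi_trudi N lam F2) / 2"
proof -
  let ?s = "\<lambda>mu. (\<Sum>i<N. mu i)"
  have "jacobi_trudi N lam F2 = (-1) ^ ?s lam * jacobi_trudi N lam (fps_flip F2)"
    by (metis jacobi_trudi_flip fps_flip_flip)
  also have "\<dots> = (-1) ^ ?s lam * (\<Sum>mu\<in>interlacing lam. jacobi_trudi N mu (fps_flip F))"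
    by (simp add: jacobi_trudi_interlacing_sum[OF lam, of "fps_flip F2"] flip: F(2) fps_flip_one_plus_X fps_flip_mult)
  also have "\<dots> = (\<Sum>mu\<in>interlacing lam. (-1) ^ (\<Sum>i<N. lam i + mu i) * jacobi_trudi N mu F)"
    by (simp add: sum_distrib_left jacobi_trudi_flip power_add sum.distrib mult.assoc)
  finally have "jacobi_trudi N lam F1 + jacobi_trudi N lam F2 =
      (\<Sum>mu\<in>interlacing lam. jacobi_trudi N mu F + (-1) ^ (\<Sum>i<N. lam i + mu i) * jacobi_trudi N mu F)"
    using jacobi_trudi_interlacing_sum[OF lam, of F1] F(1) by (simp add: sum.distrib)
  also have "\<dots> = (\<Sum>mu\<in>interlacing lam. if even (\<Sum>i<N. lam i + mu i) then 2 * jacobi_trudi N mu F else 0)"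
    by (intro sum.cong) auto
  also have "\<dots> = 2 * (\<Sum>mu | mu \<in> interlacing lam \<and> even (\<Sum>i<N. lam i + mu i). jacobi_trudi N mu F)"
    using finite_interlacing[OF lam] by (simp add: sum_distrib_left flip: sum.inter_filter)
  finally show ?thesis by simp
qed

lemma jacobi_trudi_zero:
  assumes "\<And>i. i < N \<Longrightarrow> lam i = 0" and "fps_nth F 0 = 1"
  shows "jacobi_trudi N lam F = 1"
proof -
  let ?A = "mat N N (\<lambda>(i, j). fps_nth_int F (int (lam i) - int i + int j))"
  have "det ?A = prod_list (diag_mat ?A)"
    by (rule det_upper_triangular[of _ N]) (auto simp: upper_triangular_def assms fps_nth_int_def)
  also have "\<dots> = 1"
    by (simp add: prod_list_diag_prod assms fps_nth_int_def)
  finally show ?thesis by (simp add: jacobi_trudi_def)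
qed

text \<open>Row 0 has only positive indices and hence vanishes.\<close>

lemma jacobi_trudi_one:
  assumes "0 < N" "0 < lam 0"
  shows "jacobi_trudi N lam 1 = 0"
  using assms
  by (auto simp: jacobi_trudi_def det_mat_leibniz fps_nth_int_def intro!: sum.neutral prod_zero bexI[of _ 0])

text \<open>A Schur function in the single variable 1. With at most one part the matrix is
  unitriangular; with \<open>lam 1 > 0\<close> its rows 0 and 1 consist of ones throughout.\<close>

lemma jacobi_trudi_geometric:
  assumes lam: "lam \<in> partitions_upto N" and N: "0 < N"
  shows "jacobi_trudi N lam (Abs_fps (\<lambda>_. 1)) = (if lam 1 = 0 then 1 else 0)"
proof (cases "lam 1 = 0")
  case True
  let ?A = "mat N N (\<lambda>(i, j). fps_nth_int (Abs_fps (\<lambda>_. 1)) (int (lam i) - int i + int j))"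
  have z: "lam i = 0" if "i > 0" for i
    using that lam True
    by (induction i) (auto simp: partitions_upto_def, metis One_nat_def bot_nat_0.extremum_uniqueI gr0I)
  have "det ?A = prod_list (diag_mat ?A)"
    by (rule det_upper_triangular[of _ N]) (auto simp: upper_triangular_def z fps_nth_int_def)
  also have "\<dots> = 1"
    by (simp add: prod_list_diag_prod fps_nth_int_def)
  finally show ?thesis using True by (simp add: jacobi_trudi_def)
next
  case False
  have "\<not> N \<le> 1" using False lam by (auto simp: partitions_upto_def)
  moreover have "lam 0 \<noteq> 0"
    using False lam by (metis (no_types, lifting) One_nat_def le_0_eq mem_Collect_eq partitions_upto_def)
  ultimately have "jacobi_trudi N lam (Abs_fps (\<lambda>_. 1)) = 0"
    unfolding jacobi_trudi_def using False
    by (intro det_identical_rows[of _ N 0 1]) (auto simp: fps_nth_int_def intro!: eq_vecI)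
  then show ?thesis using False by simp
qed

section \<open>Ballot words\<close>

text \<open>
  A word records the rows of the entries of a tableau, \<^emph>\<open>the largest entry first\<close>. A descent of
  the tableau is therefore a strict decrease in the word, and a run without descents is sorted.
\<close>

fun zigzag :: "nat list \<Rightarrow> bool" where
  "zigzag [] = True"
| "zigzag [x] = True"
| "zigzag (x # y # w) = (x \<le> y \<and> (w = [] \<or> hd w < y) \<and> zigzag w)"

text \<open>The letter at the head stands for a new largest entry, so \<open>w\<close> describes the
  tableau before row \<open>r\<close> grows; the test keeps row \<open>r\<close> no longer than row
  \<open>r - 1\<close>.\<close>

fun ballot :: "nat list \<Rightarrow> bool" where
  "ballot [] = True"
| "ballot (r # w) = (ballot w \<and> (r = 0 \<or> count_list w r < count_list w (r - 1)))"

definition ballot_words :: "(nat \<Rightarrow> nat) \<Rightarrow> nat list set" where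
  "ballot_words lam = {w. ballot w \<and> count_list w = lam}"

text \<open>Write the word as \<open>u @ x # y # v\<close> with \<open>length u = 2 * k\<close>.
  Once the prefix ending in \<open>y\<close> is sorted, either \<open>v\<close> begins with a letter
  at least \<open>y\<close>, which lengthens the sorted prefix, or \<open>v\<close> is empty or
  begins with a smaller letter, and then \<open>x # y # v\<close> is itself zigzag.\<close>

lemma sorted_zigzag_telescope:
  assumes "2 * k + 2 \<le> length w"
  shows "(if sorted (take (2 * k + 2) w) \<and> zigzag (drop (2 * k + 2) w) then 1 else 0 :: int) =
    (if sorted (take (2 * k + 3) w) \<and> zigzag (drop (2 * k + 2) w) \<and> 2 * k + 2 < length w then 1 else 0) +
    (if sorted (take (2 * k + 1) w) \<and> zigzag (drop (2 * k) w) then 1 else 0)"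
proof -
  define u where "u = take (2 * k) w"
  have "2 \<le> length (drop (2 * k) w)" using assms by simp
  then obtain x y v where d: "drop (2 * k) w = x # y # v"
    by (cases "drop (2 * k) w" rule: zigzag.cases) simp_all
  have w: "w = u @ x # y # v" and u: "length u = 2 * k"
    using assms append_take_drop_id[of "2 * k" w] unfolding u_def d by auto
  show ?thesis
    by (cases v) (auto simp: w u sorted_append; force)+
qed

text \<open>With \<open>a k\<close> for even and \<open>b k\<close> for odd sorted prefixes,
  \<open>a (Suc k) = b (Suc k) + b k\<close> and \<open>a 0 = b 0\<close>, so the alternating sum
  collapses to its last \<open>b\<close>.\<close>

lemma alternating_sum_sorted_zigzag:
  assumes "w \<noteq> []"
  shows "(\<Sum>k\<le>length w div 2. (-1) ^ k * (if sorted (take (2 * k) w) \<and> zigzag (drop (2 * k) w) then 1 else 0)) =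
    (if odd (length w) \<and> sorted w then (-1) ^ (length w div 2) else (0::int))"
proof -
  define a where "a k = (if sorted (take (2 * k) w) \<and> zigzag (drop (2 * k) w) then 1 else (0::int))" for k
  \<comment> \<open>The condition \<open>2 * k < length w\<close> makes \<open>b\<close> vanish at
    the end of a word of even length.\<close>
  define b where "b k = (if sorted (take (2 * k + 1) w) \<and> zigzag (drop (2 * k) w) \<and> 2 * k < length w
    then 1 else (0::int))" for k
  have step: "a (Suc k) = b (Suc k) + b k" if "2 * Suc k \<le> length w" for k
    using sorted_zigzag_telescope[of k w] that by (simp add: a_def b_def numeral_3_eq_3)
  have tel: "(\<Sum>k\<le>K. (-1) ^ k * a k) = (-1) ^ K * b K" if "2 * K \<le> length w" for K
    using that
  proof (induction K)
    case 0
    then show ?case using assms by (cases w) (simp_all add: a_def b_def)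
  next
    case (Suc K)
    then show ?case by (simp add: step algebra_simps)
  qed
  have "b (length w div 2) = (if odd (length w) \<and> sorted w then 1 else 0)"
  proof (cases "odd (length w)")
    case True
    then have len: "Suc (2 * (length w div 2)) = length w" by presburger
    then have "length (drop (2 * (length w div 2)) w) = Suc 0" unfolding length_drop by presburger
    then obtain z where z: "drop (2 * (length w div 2)) w = [z]"
      by (metis length_0_conv length_Suc_conv)
    have "take (2 * (length w div 2) + 1) w = w" "2 * (length w div 2) < length w"
      using len by simp_all
    with True z show ?thesis unfolding b_def by (simp only: zigzag.simps) simp
  next
    case False
    then show ?thesis by (simp add: b_def)
  qed
  with tel[of "length w div 2"] show ?thesis
    by (simp add: a_def)
qed

lemma ballot_count_list_le: "ballot w \<Longrightarrow> count_list w (Suc i) \<le> count_list w i"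
  by (induction w) (auto simp: less_Suc_eq_le Suc_le_eq le_Suc_eq)

text \<open>The letters of a sorted prefix are placed from right to left, lowest rows first. When
  \<open>r\<close> is placed, row \<open>r - 1\<close> still has its length from \<open>v\<close>,
  so the ballot condition becomes the horizontal strip condition.\<close>

lemma ballot_append_sorted:
  "sorted u \<Longrightarrow> ballot (u @ v) \<longleftrightarrow> ballot v \<and> (\<forall>i. count_list (u @ v) (Suc i) \<le> count_list v i)"
proof (induction u)
  case (Cons r u)
  have *: "count_list u i = 0" if "i < r" for i
    using Cons.prems that by (auto simp: count_list_0_iff)
  show ?case
  proof (cases r)
    case 0
    then show ?thesis using Cons by auto
  next
    case (Suc q)
    have "count_list u q = 0" using *[of q] Suc by simp
    then show ?thesis using Cons Suc by (auto simp: Suc_le_eq)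
  qed
qed (use ballot_count_list_le in auto)

lemma sorted_eq_if_count_list_eq:
  assumes "sorted u" "sorted v" "count_list u = count_list v"
  shows "u = v"
proof -
  have "mset u = mset v"
    using assms(3) by (intro multiset_eqI) (simp add: count_mset fun_eq_iff)
  with assms(1,2) show ?thesis by (metis properties_for_sort)
qed

lemma exists_sorted_with_count_list:
  fixes c :: "nat \<Rightarrow> nat"
  assumes "finite {i. c i > 0}"
  obtains u where "sorted u" "count_list u = c"
proof
  let ?u = "sorted_list_of_multiset (Abs_multiset c)"
  show "sorted ?u" by simp
  show "count_list ?u = c"
    using assms by (auto simp: fun_eq_iff simp flip: count_mset)
qed

lemma ballot_words_length:
  assumes "w \<in> ballot_words lam" "lam \<in> partitions_upto N"
  shows "set w \<subseteq> {..<N}" "length w = (\<Sum>i<N. lam i)"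
proof -
  have c: "count_list w = lam" using assms by (simp add: ballot_words_def)
  have "i < N" if "i \<in> set w" for i
  proof (rule ccontr)
    assume "\<not> i < N"
    then have "count_list w i = 0" using assms c by (simp add: partitions_upto_def)
    with that show False by (simp add: count_list_0_iff)
  qed
  then show s: "set w \<subseteq> {..<N}" by auto
  then show "length w = (\<Sum>i<N. lam i)"
    using sum_count_set[OF s] c by simp
qed

lemma finite_ballot_words:
  assumes "lam \<in> partitions_upto N"
  shows "finite (ballot_words lam)"
  by (rule finite_subset[OF _ finite_lists_length_eq[of "{..<N}" "\<Sum>i<N. lam i"]])
     (use ballot_words_length[OF _ assms] in auto)

text \<open>Deleting a sorted prefix of length \<open>k\<close> removes a horizontal strip of size
  \<open>k\<close>. A sorted word is determined by its letter counts, so the prefix is recovered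
  from \<open>lam\<close> and \<open>mu\<close>.\<close>

lemma bij_betw_ballot_words_sorted_prefix:
  assumes lam: "lam \<in> partitions_upto N" and k: "k \<le> (\<Sum>i<N. lam i)"
  shows "bij_betw (drop k) {w \<in> ballot_words lam. sorted (take k w)}
          (\<Union>mu\<in>{mu \<in> interlacing lam. (\<Sum>i<N. lam i) = (\<Sum>i<N. mu i) + k}. ballot_words mu)"
    (is "bij_betw _ ?A ?B")
  unfolding bij_betw_def
proof (intro conjI subset_antisym subsetI)
  show "inj_on (drop k) ?A"
  proof (rule inj_onI)
    fix w w' assume A: "w \<in> ?A" "w' \<in> ?A" and d: "drop k w = drop k w'"
    have "count_list (take k w @ drop k w) = count_list (take k w' @ drop k w')"
      using A by (simp add: ballot_words_def)
    then have "count_list (take k w) = count_list (take k w')"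
      unfolding fun_eq_iff count_list_append d by simp
    then have "take k w = take k w'"
      using A by (intro sorted_eq_if_count_list_eq) auto
    with d show "w = w'" by (metis append_take_drop_id)
  qed
next
  fix v assume "v \<in> drop k ` ?A"
  then obtain w where w: "w \<in> ballot_words lam" "sorted (take k w)" and v: "v = drop k w" by auto
  have app: "take k w @ v = w" by (simp add: v)
  have "count_list (take k w @ v) = lam" using w(1) unfolding app by (simp add: ballot_words_def)
  then have c: "lam i = count_list (take k w) i + count_list v i" for i by auto
  have "ballot (take k w @ v)" using w(1) app by (simp add: ballot_words_def)
  then have b: "ballot v" "\<And>i. count_list (take k w @ v) (Suc i) \<le> count_list v i"
    using ballot_append_sorted[OF w(2), of v] by auto
  have il: "count_list v \<in> interlacing lam"
    using b(2) by (auto simp: interlacing_def c)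
  have vb: "v \<in> ballot_words (count_list v)" using b by (simp add: ballot_words_def)
  have "length v = (\<Sum>i<N. count_list v i)"
    by (rule ballot_words_length(2)[OF vb interlacing_partitions_upto[OF lam il]])
  moreover have "length w = (\<Sum>i<N. lam i)" by (rule ballot_words_length(2)[OF w(1) lam])
  ultimately have "(\<Sum>i<N. lam i) = (\<Sum>i<N. count_list v i) + k"
    using k v by simp
  then show "v \<in> ?B" using il vb by blast
next
  fix v assume "v \<in> ?B"
  then obtain mu where mu: "mu \<in> interlacing lam" "(\<Sum>i<N. lam i) = (\<Sum>i<N. mu i) + k"
    and v: "v \<in> ballot_words mu" by auto
  have "{i. 0 < lam i - mu i} \<subseteq> {..<N}"
    using lam by (auto simp: partitions_upto_def not_less[symmetric])
  then have "finite {i. 0 < lam i - mu i}" by (rule finite_subset) simp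
  then obtain u where u: "sorted u" "count_list u = (\<lambda>i. lam i - mu i)"
    by (rule exists_sorted_with_count_list)
  have le: "mu i \<le> lam i" "lam (Suc i) \<le> mu i" for i using mu by (auto simp: interlacing_def)
  have c: "count_list (u @ v) = lam"
    using v u(2) le(1) by (auto simp: ballot_words_def fun_eq_iff)
  have "ballot (u @ v)"
    using v le(2) c by (simp add: ballot_append_sorted[OF u(1)] ballot_words_def del: count_list_append)
  with c have uv: "u @ v \<in> ballot_words lam" by (simp add: ballot_words_def)
  have "length v = (\<Sum>i<N. mu i)"
    by (rule ballot_words_length(2)[OF v interlacing_partitions_upto[OF lam mu(1)]])
  then have "length u = k"
    using ballot_words_length(2)[OF uv lam] mu(2) by simp
  then show "v \<in> drop k ` ?A"
    using uv u(1) by (intro image_eqI[of _ _ "u @ v"]) auto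
qed

lemma interlacing_zero_iff:
  assumes "lam \<in> partitions_upto N"
  shows "(\<lambda>_. 0) \<in> interlacing lam \<longleftrightarrow> lam 1 = 0"
proof
  assume "lam 1 = 0"
  then have "lam (Suc i) = 0" for i
    using assms by (induction i) (auto simp: partitions_upto_def, metis le_0_eq)
  then show "(\<lambda>_. 0) \<in> interlacing lam" by (simp add: interlacing_def)
qed (auto simp: interlacing_def)

lemma ballot_words_zero: "ballot_words (\<lambda>_. 0) = {[]}"
proof -
  have "w = []" if "count_list w = (\<lambda>_. 0)" for w
    using that count_list_0_iff[of w] by (metis list.set_intros(1) neq_Nil_conv)
  then show ?thesis by (auto simp: ballot_words_def)
qed

text \<open>Here the sorted prefix is the whole word, so \<open>mu\<close> is empty and
  \<open>lam\<close> is itself a horizontal strip, that is, has at most one row.\<close>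

lemma card_sorted_ballot_words:
  assumes lam: "lam \<in> partitions_upto N"
  shows "card {w \<in> ballot_words lam. sorted w} = (if lam 1 = 0 then 1 else 0)"
proof -
  let ?n = "\<Sum>i<N. lam i"
  have "{w \<in> ballot_words lam. sorted w} = {w \<in> ballot_words lam. sorted (take ?n w)}"
    using ballot_words_length(2)[OF _ lam] by auto
  then have "card {w \<in> ballot_words lam. sorted w} =
     card (\<Union>mu\<in>{mu \<in> interlacing lam. ?n = (\<Sum>i<N. mu i) + ?n}. ballot_words mu)"
    using bij_betw_same_card[OF bij_betw_ballot_words_sorted_prefix[OF lam, of ?n]] by simp
  also have "{mu \<in> interlacing lam. ?n = (\<Sum>i<N. mu i) + ?n} = (if lam 1 = 0 then {\<lambda>_. 0} else {})"
  proof -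
    have "mu = (\<lambda>_. 0)" if "mu \<in> interlacing lam" "?n = (\<Sum>i<N. mu i) + ?n" for mu
    proof
      fix i
      show "mu i = 0"
        using that interlacing_partitions_upto[OF lam that(1)]
        by (cases "i < N") (auto simp: partitions_upto_def)
    qed
    then have "{mu \<in> interlacing lam. ?n = (\<Sum>i<N. mu i) + ?n} = {\<lambda>_. 0} \<inter> interlacing lam" by auto
    then show ?thesis using interlacing_zero_iff[OF lam] by auto
  qed
  finally show ?thesis by (simp add: ballot_words_zero)
qed

definition signed_zigzag_count :: "nat \<Rightarrow> (nat \<Rightarrow> nat) \<Rightarrow> int" where
  "signed_zigzag_count N lam =
     (-1) ^ ((\<Sum>i<N. lam i) div 2) * int (card {w \<in> ballot_words lam. zigzag w})"

lemma signed_zigzag_count_zero: "signed_zigzag_count N (\<lambda>_. 0) = 1"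
proof -
  have "{w \<in> ballot_words (\<lambda>_. 0). zigzag w} = {[]}" by (auto simp: ballot_words_zero)
  then show ?thesis by (simp add: signed_zigzag_count_def)
qed

text \<open>Restricts \<open>bij_betw_ballot_words_sorted_prefix\<close> to words whose remainder is
  zigzag. The exponents of the two signs have equal parity because \<open>mu\<close> is smaller than
  \<open>lam\<close> by \<open>2 * k\<close> cells.\<close>

lemma card_sorted_zigzag_ballot_words:
  assumes lam: "lam \<in> partitions_upto N"
    and k: "2 * k \<le> (\<Sum>i<N. lam i)"
  shows "(-1) ^ ((\<Sum>i<N. lam i) div 2 + k) *
    int (card {w \<in> ballot_words lam. sorted (take (2 * k) w) \<and> zigzag (drop (2 * k) w)}) =
    (\<Sum>mu | mu \<in> interlacing lam \<and> (\<Sum>i<N. lam i) = (\<Sum>i<N. mu i) + 2 * k. signed_zigzag_count N mu)"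
proof -
  let ?n = "\<Sum>i<N. lam i"
  let ?I = "{mu. mu \<in> interlacing lam \<and> ?n = (\<Sum>i<N. mu i) + 2 * k}"
  let ?B = "\<lambda>mu. {w \<in> ballot_words mu. zigzag w}"
  have "bij_betw (drop (2 * k)) {w \<in> ballot_words lam. sorted (take (2 * k) w)} (\<Union>mu\<in>?I. ballot_words mu)"
    by (rule bij_betw_ballot_words_sorted_prefix[OF lam k])
  then have "bij_betw (drop (2 * k)) {w \<in> ballot_words lam. sorted (take (2 * k) w) \<and> zigzag (drop (2 * k) w)}
     (\<Union>mu\<in>?I. ?B mu)"
    unfolding bij_betw_def inj_on_def by auto
  then have "card {w \<in> ballot_words lam. sorted (take (2 * k) w) \<and> zigzag (drop (2 * k) w)} =
      card (\<Union>mu\<in>?I. ?B mu)"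
    by (rule bij_betw_same_card)
  also have "\<dots> = (\<Sum>mu\<in>?I. card (?B mu))"
  proof (rule card_UN_disjoint)
    show "finite ?I" using finite_interlacing[OF lam] by simp
    show "\<forall>mu\<in>?I. finite (?B mu)"
      using finite_ballot_words[OF interlacing_partitions_upto[OF lam]] by auto
    show "\<forall>mu\<in>?I. \<forall>nu\<in>?I. mu \<noteq> nu \<longrightarrow> ?B mu \<inter> ?B nu = {}"
      by (auto simp: ballot_words_def)
  qed
  finally have "(-1) ^ (?n div 2 + k) * int (card {w \<in> ballot_words lam. sorted (take (2 * k) w) \<and> zigzag (drop (2 * k) w)}) =
      (\<Sum>mu\<in>?I. (-1) ^ (?n div 2 + k) * int (card (?B mu)))"
    by (simp add: sum_distrib_left)
  also have "\<dots> = (\<Sum>mu\<in>?I. signed_zigzag_count N mu)"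
    unfolding signed_zigzag_count_def
  proof (rule sum.cong[OF refl])
    fix mu assume "mu \<in> ?I"
    then have "?n div 2 + k = (\<Sum>i<N. mu i) div 2 + 2 * k" by simp
    then show "(-1) ^ (?n div 2 + k) * int (card (?B mu)) =
       (-1) ^ ((\<Sum>i<N. mu i) div 2) * int (card (?B mu))"
      by (simp add: power_add power_mult)
  qed
  finally show ?thesis .
qed

text \<open>Strips are grouped by their size \<open>2 * k\<close> and the sums interchanged; for
  each word the alternating sum over \<open>k\<close> collapses, and only sorted words of odd length
  remain.\<close>

lemma sum_interlacing_signed_zigzag_count:
  assumes lam: "lam \<in> partitions_upto N"
    and pos: "0 < (\<Sum>i<N. lam i)"
  shows "(\<Sum>mu | mu \<in> interlacing lam \<and> even (\<Sum>i<N. lam i + mu i). signed_zigzag_count N mu) =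
    (if odd (\<Sum>i<N. lam i) \<and> lam 1 = 0 then 1 else 0)"
proof -
  let ?n = "\<Sum>i<N. lam i"
  let ?I = "\<lambda>k. {mu. mu \<in> interlacing lam \<and> ?n = (\<Sum>i<N. mu i) + 2 * k}"
  let ?a = "\<lambda>k w. if sorted (take (2 * k) w) \<and> zigzag (drop (2 * k) w) then 1 else 0 :: int"
  have finB: "finite (ballot_words lam)" by (rule finite_ballot_words[OF lam])
  have un: "{mu. mu \<in> interlacing lam \<and> even (\<Sum>i<N. lam i + mu i)} = (\<Union>k\<le>?n div 2. ?I k)" (is "?L = ?R")
  proof
    show "?L \<subseteq> ?R"
    proof
      fix mu assume mu: "mu \<in> ?L"
      have "(\<Sum>i<N. mu i) \<le> ?n"
        using mu by (intro sum_mono) (auto simp: interlacing_def)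
      moreover have "even (?n + (\<Sum>i<N. mu i))" using mu by (simp add: sum.distrib)
      ultimately have "?n = (\<Sum>i<N. mu i) + 2 * ((?n - (\<Sum>i<N. mu i)) div 2)"
        by auto
      moreover have "(?n - (\<Sum>i<N. mu i)) div 2 \<le> ?n div 2" by (simp add: div_le_mono)
      ultimately show "mu \<in> ?R" using mu by blast
    qed
    show "?R \<subseteq> ?L" by (auto simp: sum.distrib)
  qed
  have "(\<Sum>mu\<in>?L. signed_zigzag_count N mu) = (\<Sum>k\<le>?n div 2. \<Sum>mu\<in>?I k. signed_zigzag_count N mu)"
    unfolding un by (rule sum.UNION_disjoint) (use finite_interlacing[OF lam] in auto)
  also have "\<dots> = (\<Sum>k\<le>?n div 2. (-1) ^ (?n div 2 + k) *
     int (card {w \<in> ballot_words lam. sorted (take (2 * k) w) \<and> zigzag (drop (2 * k) w)}))"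
    by (intro sum.cong refl card_sorted_zigzag_ballot_words[OF lam, symmetric]) auto
  also have "\<dots> = (\<Sum>k\<le>?n div 2. (-1) ^ (?n div 2 + k) * (\<Sum>w\<in>ballot_words lam. ?a k w))"
    using finB by (intro sum.cong refl arg_cong2[of _ _ _ _ "(*)"]) (simp add: sum.If_cases Int_def)
  also have "\<dots> = (-1) ^ (?n div 2) * (\<Sum>w\<in>ballot_words lam. \<Sum>k\<le>?n div 2. (-1) ^ k * ?a k w)"
    by (subst sum.swap) (simp add: sum_distrib_left power_add mult.assoc)
  also have "(\<Sum>w\<in>ballot_words lam. \<Sum>k\<le>?n div 2. (-1) ^ k * ?a k w) =
     (\<Sum>w\<in>ballot_words lam. if odd ?n \<and> sorted w then (-1) ^ (?n div 2) else 0)"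
  proof (rule sum.cong[OF refl])
    fix w assume w: "w \<in> ballot_words lam"
    then have len: "length w = ?n" by (rule ballot_words_length(2)[OF _ lam])
    then have "w \<noteq> []" using pos by auto
    from alternating_sum_sorted_zigzag[OF this]
    show "(\<Sum>k\<le>?n div 2. (-1) ^ k * ?a k w) = (if odd ?n \<and> sorted w then (-1) ^ (?n div 2) else 0)"
      by (simp only: len)
  qed
  also have "(-1) ^ (?n div 2) * \<dots> = (if odd ?n then int (card {w \<in> ballot_words lam. sorted w}) else 0)"
    using finB by (simp add: sum.If_cases Int_def power_add[symmetric])
  finally show ?thesis
    by (simp add: card_sorted_ballot_words[OF lam])
qed

section \<open>Umbral evaluation of the determinants\<close>

text \<open>The signs amount to the substitution \<open>E = \<i> u\<close>; they replace \<open>sec + tan\<close> by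
  \<open>sech + tanh\<close> and keep all coefficients real.\<close>

definition signed_umbral_eval :: "real poly \<Rightarrow> real" where
  "signed_umbral_eval p = (\<Sum>i\<le>degree p. coeff p i * ((-1) ^ (i div 2) * euler_number i))"

lemma signed_umbral_eval_eq:
  assumes "degree p \<le> n"
  shows "signed_umbral_eval p = (\<Sum>i\<le>n. coeff p i * ((-1) ^ (i div 2) * euler_number i))"
  unfolding signed_umbral_eval_def
  by (rule sum.mono_neutral_left) (use assms in \<open>auto simp: coeff_eq_0\<close>)

lemma signed_umbral_eval_add: "signed_umbral_eval (p + q) = signed_umbral_eval p + signed_umbral_eval q"
proof -
  let ?n = "max (degree p) (degree q)"
  show ?thesis
    by (simp add: signed_umbral_eval_eq[of p ?n] signed_umbral_eval_eq[of q ?n] degree_add_le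
          signed_umbral_eval_eq[of "p + q" ?n] sum.distrib distrib_right)
qed

lemma signed_umbral_eval_smult: "signed_umbral_eval (Polynomial.smult c p) = c * signed_umbral_eval p"
  by (simp add: signed_umbral_eval_eq[of "Polynomial.smult c p" "degree p"] degree_smult_le
      signed_umbral_eval_def sum_distrib_left mult.assoc)

lemma signed_umbral_eval_0: "signed_umbral_eval 0 = 0"
  by (simp add: signed_umbral_eval_def)

lemma signed_umbral_eval_sum: "signed_umbral_eval (\<Sum>x\<in>A. f x) = (\<Sum>x\<in>A. signed_umbral_eval (f x))"
  by (induction A rule: infinite_finite_induct) (auto simp: signed_umbral_eval_add signed_umbral_eval_0)

section \<open>The functional equation coming from secant and tangent\<close>

lemma sec_plus_tan_mult_cos:
  "(inverse (fps_cos 1) + fps_tan 1) * fps_cos (1::real) = 1 + fps_sin 1"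
proof -
  have "inverse (fps_cos 1) * fps_cos (1::real) = 1"
    by (rule inverse_mult_eq_1) simp
  then show ?thesis
    by (simp add: fps_tan_def fps_divide_unit distrib_right mult.assoc)
qed

text \<open>Coefficient \<open>n\<close> of \<open>(sec + tan) * cos = 1 + sin\<close>, times
  \<open>fact n\<close> and \<open>(-1) ^ (n div 2)\<close>. Only even \<open>n - i\<close> carry a
  cosine coefficient, whose sign turns \<open>(-1) ^ (n div 2)\<close> into
  \<open>(-1) ^ (i div 2)\<close>.\<close>

lemma sum_even_choose_signed_euler:
  "(\<Sum>i\<le>n. if even (n - i) then real (n choose i) * ((-1) ^ (i div 2) * euler_number i) else 0) =
     (if n = 0 \<or> odd n then 1 else 0)"
proof -
  let ?S = "inverse (fps_cos 1) + fps_tan (1::real)"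
  have "(if even (n - i) then real (n choose i) * ((-1) ^ (i div 2) * euler_number i) else 0) =
    fact n * (-1) ^ (n div 2) * (fps_nth ?S i * fps_nth (fps_cos 1) (n - i))" if "i \<le> n" for i
  proof (cases "even (n - i)")
    case True
    then obtain k where "n - i = 2 * k" by (elim evenE)
    then have k: "n = i + 2 * k" using that by simp
    have "(-1::real) ^ k * (-1) ^ k = 1" by (simp flip: power_mult_distrib)
    then have "(-1::real) ^ (n div 2) * (-1) ^ ((n - i) div 2) = (-1) ^ (i div 2)"
      unfolding k by (simp add: power_add mult.assoc)
    moreover have "real (n choose i) = fact n / (fact i * fact (n - i))"
      using that by (rule binomial_fact)
    ultimately show ?thesis using True
      by (simp add: euler_number_def fps_cos_def del: fps_add_nth flip: \<open>_ = (-1) ^ (i div 2)\<close>)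
  next
    case False
    then show ?thesis by (simp add: fps_cos_def)
  qed
  then have "(\<Sum>i\<le>n. if even (n - i) then real (n choose i) * ((-1) ^ (i div 2) * euler_number i) else 0) =
    fact n * (-1) ^ (n div 2) * fps_nth (?S * fps_cos 1) n"
    by (simp add: fps_mult_nth sum_distrib_left atMost_atLeast0 del: fps_add_nth)
  also have "\<dots> = fact n * (-1) ^ (n div 2) * fps_nth (1 + fps_sin 1) n"
    by (simp only: sec_plus_tan_mult_cos)
  also have "\<dots> = (if n = 0 \<or> odd n then 1 else 0)"
    by (auto simp: fps_sin_def elim!: oddE)
  finally show ?thesis .
qed

text \<open>In the sum of the two powers the terms with \<open>n - i\<close> odd cancel and the
  others double.\<close>

lemma signed_umbral_eval_shift_power:
  "signed_umbral_eval ([:1, 1:] ^ n + [:- 1, 1:] ^ n) = (if n = 0 \<or> odd n then 2 else 0)"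
proof -
  have "degree ([:1, 1:] ^ n + [:- 1, 1::real:] ^ n) \<le> n"
    by (intro degree_add_le) (simp_all add: degree_linear_power)
  then have "signed_umbral_eval ([:1, 1:] ^ n + [:- 1, 1:] ^ n) =
     (\<Sum>i\<le>n. 2 * (if even (n - i) then real (n choose i) * ((-1) ^ (i div 2) * euler_number i) else 0))"
    by (subst signed_umbral_eval_eq) (auto intro!: sum.cong simp: coeff_linear_poly_power)
  then show ?thesis
    by (simp only: sum_distrib_left[symmetric] sum_even_choose_signed_euler) simp
qed

text \<open>By linearity it suffices to treat powers, where
  \<open>2 * 0 ^ i + 1 ^ i - (- 1) ^ i\<close> is 2 for \<open>i\<close> zero or odd and 0
  otherwise.\<close>

lemma signed_umbral_eval_shift:
  "signed_umbral_eval (pcompose p [:1, 1:] + pcompose p [:- 1, 1:]) = 2 * poly p 0 + poly p 1 - poly p (- 1)"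
proof -
  have "pcompose (\<Sum>i\<le>degree p. monom (coeff p i) i) q = (\<Sum>i\<le>degree p. Polynomial.smult (coeff p i) (q ^ i))" for q :: "real poly"
    by (intro iffD1[OF poly_eq_poly_eq_iff] ext) (simp add: poly_pcompose poly_sum poly_monom)
  then have "pcompose p q = (\<Sum>i\<le>degree p. Polynomial.smult (coeff p i) (q ^ i))" for q
    by (simp add: poly_as_sum_of_monoms)
  then have "signed_umbral_eval (pcompose p [:1, 1:] + pcompose p [:- 1, 1:]) =
     (\<Sum>i\<le>degree p. coeff p i * signed_umbral_eval ([:1, 1:] ^ i + [:- 1, 1:] ^ i))"
    by (simp add: signed_umbral_eval_add signed_umbral_eval_sum signed_umbral_eval_smult sum.distrib distrib_left)
  also have "\<dots> = (\<Sum>i\<le>degree p. coeff p i * (2 * 0 ^ i + 1 ^ i - (- 1) ^ i))"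
    by (intro sum.cong) (auto simp: signed_umbral_eval_shift_power)
  also have "\<dots> = 2 * poly p 0 + poly p 1 - poly p (- 1)"
    by (simp only: poly_altdef sum_distrib_left sum.distrib[symmetric] sum_subtractf[symmetric])
       (simp add: algebra_simps)
  finally show ?thesis .
qed

section \<open>The interpolating power series and its coefficient polynomials\<close>

text \<open>This is \<open>(1 - z^2)^a exp (u artanh z)\<close>.\<close>

definition arctanh_series :: "real \<Rightarrow> real \<Rightarrow> real fps" where
  "arctanh_series a u = fps_binomial (a + u / 2) * fps_flip (fps_binomial (a - u / 2))"

lemma fps_binomial_add_one: "fps_binomial (c + 1) = fps_binomial c * (1 + fps_X :: real fps)"
  by (simp add: fps_binomial_add_mult fps_binomial_1)

text \<open>The exponent \<open>a + u / 2\<close> of \<open>1 + z\<close> is kept while that of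
  \<open>1 - z\<close> drops by one; in the companion lemma the roles are exchanged. The two provide
  \<open>F1\<close> and \<open>F2\<close> of
  \<open>jacobi_trudi_even_interlacing_sum\<close>.\<close>

lemma arctanh_series_shift_up: "arctanh_series (a - 1 / 2) (u + 1) * (1 - fps_X) = arctanh_series a u"
proof -
  have "fps_flip (fps_binomial (a - u / 2 - 1)) * (1 - fps_X) = fps_flip (fps_binomial (a - u / 2))"
    using fps_binomial_add_one[of "a - u / 2 - 1"]
    by (simp flip: fps_flip_one_plus_X fps_flip_mult)
  then show ?thesis
    by (simp add: arctanh_series_def add_divide_distrib mult.assoc)
qed

lemma arctanh_series_shift_down: "arctanh_series (a - 1 / 2) (u - 1) * (1 + fps_X) = arctanh_series a u"
proof -
  have "fps_binomial (a + u / 2 - 1) * (1 + fps_X) = fps_binomial (a + u / 2)"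
    using fps_binomial_add_one[of "a + u / 2 - 1"] by simp
  then show ?thesis
    by (simp add: arctanh_series_def diff_divide_distrib mult_ac)
qed

lemma fps_flip_arctanh_series: "fps_flip (arctanh_series a u) = arctanh_series a (- u)"
  by (simp add: arctanh_series_def fps_flip_mult mult.commute)

lemma arctanh_series_half: "arctanh_series (- 1 / 2) 1 = Abs_fps (\<lambda>_. 1)"
proof -
  have "((- 1 :: real) gchoose n) = (-1) ^ n" for n
    using gbinomial_minus[of "1::real" n] by (simp add: binomial_gbinomial[symmetric])
  then show ?thesis
    by (intro fps_ext) (simp add: arctanh_series_def fps_flip_def flip: power_mult_distrib)
qed

lemma arctanh_series_0_0: "arctanh_series 0 0 = 1"
  by (rule fps_ext) (simp add: arctanh_series_def fps_flip_def)

lemma arctanh_series_nth_0: "fps_nth (arctanh_series a u) 0 = 1"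
  by (simp add: arctanh_series_def fps_flip_def)

definition gbinomial_poly :: "real \<Rightarrow> real \<Rightarrow> nat \<Rightarrow> real poly" where
  "gbinomial_poly c d n = Polynomial.smult (1 / fact n) (\<Prod>i=0..<n. [:c - real i, d:])"

lemma poly_gbinomial_poly: "poly (gbinomial_poly c d n) u = (c + d * u) gchoose n"
  by (simp add: gbinomial_poly_def poly_prod gbinomial_prod_rev algebra_simps)

definition arctanh_poly :: "real \<Rightarrow> nat \<Rightarrow> real poly" where
  "arctanh_poly a n =
     (\<Sum>i=0..n. gbinomial_poly a (1 / 2) i * Polynomial.smult ((-1) ^ (n - i)) (gbinomial_poly a (- 1 / 2) (n - i)))"

lemma poly_arctanh_poly: "poly (arctanh_poly a n) u = fps_nth (arctanh_series a u) n"
  by (simp add: arctanh_poly_def arctanh_series_def fps_mult_nth poly_sum poly_gbinomial_poly fps_flip_def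
      mult.left_commute)

text \<open>Umbral evaluation acts on an expanded polynomial in \<open>u\<close>, so the determinant
  is formed over \<open>real poly\<close>.\<close>

definition jacobi_trudi_poly :: "nat \<Rightarrow> (nat \<Rightarrow> nat) \<Rightarrow> (nat \<Rightarrow> real poly) \<Rightarrow> real poly" where
  "jacobi_trudi_poly N lam h = det (mat N N (\<lambda>(i, j).
     if int (lam i) - int i + int j < 0 then 0 else h (nat (int (lam i) - int i + int j))))"

lemma poly_jacobi_trudi_poly:
  assumes "\<And>n. poly (h n) u = fps_nth F n"
  shows "poly (jacobi_trudi_poly N lam h) u = jacobi_trudi N lam F"
proof -
  have [simp]: "poly (if b then 0 else p) u = (if b then 0 else poly p u)" for b p by simp
  have "poly (signof p :: real poly) u = signof p" for p :: "nat \<Rightarrow> nat"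
    by (simp add: sign_def)
  then show ?thesis
    unfolding jacobi_trudi_poly_def jacobi_trudi_def det_mat_leibniz
    by (simp add: poly_sum poly_prod fps_nth_int_def assms cong: if_cong)
qed

text \<open>Induction on the size: both sides satisfy the same recursion over even horizontal
  strips. The empty strip gives \<open>lam\<close> itself; all others lead to smaller shapes of the
  same parity, hence to the same \<open>a\<close>.\<close>

lemma signed_zigzag_count_eq_umbral:
  assumes "lam \<in> partitions_upto N" "0 < N"
  shows "real_of_int (signed_zigzag_count N lam) = signed_umbral_eval
    (jacobi_trudi_poly N lam (arctanh_poly (if even (\<Sum>i<N. lam i) then 1 / 2 else 0)))"
  using assms
proof (induction "\<Sum>i<N. lam i" arbitrary: lam rule: less_induct)
  case less
  note lam = less.prems(1)
  let ?n = "\<Sum>i<N. lam i"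
  \<comment> \<open>Then \<open>a - 1 / 2\<close> is 0 or \<open>- 1 / 2\<close>, where the series
    is 1 at \<open>u = 0\<close>, respectively geometric at \<open>u = 1\<close>.\<close>
  define a :: real where "a = (if even ?n then 1 / 2 else 0)"
  define P where "P mu = jacobi_trudi_poly N mu (arctanh_poly a)" for mu
  define Q where "Q = jacobi_trudi_poly N lam (arctanh_poly (a - 1 / 2))"
  have poly_P: "poly (P mu) u = jacobi_trudi N mu (arctanh_series a u)" for mu u
    unfolding P_def by (rule poly_jacobi_trudi_poly) (rule poly_arctanh_poly)
  have poly_Q: "poly Q u = jacobi_trudi N lam (arctanh_series (a - 1 / 2) u)" for u
    unfolding Q_def by (rule poly_jacobi_trudi_poly) (rule poly_arctanh_poly)
  show ?case
  proof (cases "?n = 0")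
    case True
    have "lam = (\<lambda>_. 0)"
    proof
      fix i
      show "lam i = 0"
        using True lam by (cases "i < N") (auto simp: partitions_upto_def)
    qed
    moreover from True have "poly (P lam) u = poly 1 u" for u
      unfolding poly_P by (subst jacobi_trudi_zero) (auto simp: arctanh_series_nth_0)
    then have "P lam = 1" by (intro iffD1[OF poly_eq_poly_eq_iff] ext)
    moreover have "signed_umbral_eval 1 = 1"
      using sum_even_choose_signed_euler[of 0] by (simp add: signed_umbral_eval_def)
    ultimately show ?thesis by (simp add: P_def a_def signed_zigzag_count_zero)
  next
    case False
    let ?I = "{mu. mu \<in> interlacing lam \<and> even (\<Sum>i<N. lam i + mu i)}"
    have finI: "finite ?I" using finite_interlacing[OF lam] by simp
    have lamI: "lam \<in> ?I"
      using lam by (auto simp: interlacing_def partitions_upto_def sum.distrib)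
    \<comment> \<open>The sum over even strips averages \<open>Q\<close> at \<open>u + 1\<close> and
      \<open>u - 1\<close>, so its umbral value needs only \<open>Q\<close> at 0, 1 and -1.\<close>
    have "poly (\<Sum>mu\<in>?I. P mu) u = poly (Polynomial.smult (1 / 2) (pcompose Q [:1, 1:] + pcompose Q [:- 1, 1:])) u" for u
      using jacobi_trudi_even_interlacing_sum[OF lam arctanh_series_shift_up arctanh_series_shift_down, of a u]
      by (simp add: poly_sum poly_P poly_pcompose poly_Q add.commute)
    then have "(\<Sum>mu\<in>?I. P mu) = Polynomial.smult (1 / 2) (pcompose Q [:1, 1:] + pcompose Q [:- 1, 1:])"
      by (intro iffD1[OF poly_eq_poly_eq_iff] ext)
    then have "(\<Sum>mu\<in>?I. signed_umbral_eval (P mu)) = (2 * poly Q 0 + poly Q 1 - poly Q (- 1)) / 2"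
      by (simp flip: signed_umbral_eval_sum add: signed_umbral_eval_smult signed_umbral_eval_shift)
    also have "\<dots> = (if odd ?n \<and> lam 1 = 0 then 1 else 0)"
    proof -
      \<comment> \<open>\<open>Q\<close> has the parity of \<open>?n\<close>: for even size the
        values at 1 and -1 cancel, for odd size the value at 0 vanishes.\<close>
      have flip: "poly Q (- u) = (-1) ^ ?n * poly Q u" for u
        by (simp add: poly_Q jacobi_trudi_flip flip: fps_flip_arctanh_series)
      show ?thesis
      proof (cases "even ?n")
        case True
        have "lam 0 \<noteq> 0"
        proof
          assume "lam 0 = 0"
          then have "lam i = 0" for i
            using lam by (induction i) (auto simp: partitions_upto_def, metis le_0_eq)
          with False show False by simp
        qed
        then have "poly Q 0 = 0"
          using True less.prems(2) by (simp add: poly_Q a_def arctanh_series_0_0 jacobi_trudi_one)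
        with True flip[of 1] show ?thesis by simp
      next
        case odd: False
        have "poly Q 0 = 0" using odd flip[of 0] by simp
        moreover have "poly Q 1 = (if lam 1 = 0 then 1 else 0)"
          using odd arctanh_series_half jacobi_trudi_geometric[OF lam less.prems(2)]
          by (simp add: poly_Q a_def)
        ultimately show ?thesis using odd flip[of 1] by simp
      qed
    qed
    also have "\<dots> = real_of_int (\<Sum>mu\<in>?I. signed_zigzag_count N mu)"
      using False by (simp only: sum_interlacing_signed_zigzag_count[OF lam] gr_zeroI) simp
    finally have eq: "(\<Sum>mu\<in>?I. signed_umbral_eval (P mu)) = (\<Sum>mu\<in>?I. real_of_int (signed_zigzag_count N mu))"
      by simp
    have rest: "real_of_int (signed_zigzag_count N mu) = signed_umbral_eval (P mu)" if mu: "mu \<in> ?I - {lam}" for mu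
    proof -
      have muP: "mu \<in> partitions_upto N" using mu interlacing_partitions_upto[OF lam] by auto
      have le: "mu i \<le> lam i" for i using mu by (auto simp: interlacing_def)
      obtain i where i: "mu i \<noteq> lam i" using mu by auto
      then have "i < N" using lam muP by (cases "i < N") (auto simp: partitions_upto_def)
      then have "(\<Sum>i<N. mu i) < ?n"
        using le i le_neq_implies_less by (intro sum_strict_mono_ex1) blast+
      moreover have "even (\<Sum>i<N. mu i) \<longleftrightarrow> even ?n" using mu by (auto simp: sum.distrib)
      ultimately show ?thesis
        using less.hyps[OF _ muP less.prems(2)] by (simp add: P_def a_def)
    qed
    have "signed_umbral_eval (P lam) = real_of_int (signed_zigzag_count N lam)"
      using eq rest by (simp add: sum.remove[OF finI lamI])
    then show ?thesis by (simp add: P_def a_def)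
  qed
qed

section \<open>Staircase determinants\<close>

lemma fps_nth_int_mult:
  assumes "\<And>i. K \<le> i \<Longrightarrow> int i \<le> n \<Longrightarrow> fps_nth G i = 0"
  shows "fps_nth_int (F * G) n = (\<Sum>i<K. fps_nth G i * fps_nth_int F (n - int i))"
proof (cases "n < 0")
  case True
  then show ?thesis by (simp add: fps_nth_int_def)
next
  case False
  have "fps_nth_int (F * G) n = (\<Sum>i=0..nat n. fps_nth G i * fps_nth F (nat n - i))"
    using False by (simp add: fps_nth_int_def fps_mult_nth mult.commute[of F])
  also have "\<dots> = (\<Sum>i<K. fps_nth G i * fps_nth_int F (n - int i))"
  proof (rule sum.mono_neutral_cong)
    fix i assume "i \<in> {0..nat n} \<inter> {..<K}"
    then show "fps_nth G i * fps_nth F (nat n - i) = fps_nth G i * fps_nth_int F (n - int i)"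
      using False by (auto simp: fps_nth_int_def nat_diff_distrib)
  qed (use assms False in \<open>auto simp: fps_nth_int_def\<close>)
  finally show ?thesis .
qed

lemma sum_lessThan_double: "(\<Sum>i<2 * K. f i) = (\<Sum>k<K. f (2 * k) + f (Suc (2 * k)))"
  for f :: "nat \<Rightarrow> 'a :: comm_monoid_add"
  by (induction K) (simp_all add: add.assoc)

abbreviation (input) staircase_fun :: "nat \<Rightarrow> nat \<Rightarrow> nat" where
  "staircase_fun N \<equiv> (\<lambda>i. N - i)"

lemma staircase_fun_partitions_upto: "staircase_fun N \<in> partitions_upto N"
  by (auto simp: partitions_upto_def)

lemma jacobi_trudi_staircase:
  "jacobi_trudi N (staircase_fun N) F =
     det (mat N N (\<lambda>(i, j). fps_nth_int F (int N - 2 * int i + int j)))"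
proof -
  have "int (staircase_fun N i) - int i = int N - 2 * int i" if "i < N" for i
    using that by auto
  then show ?thesis
    unfolding jacobi_trudi_def by (intro arg_cong[of _ _ det] cong_mat) auto
qed

text \<open>Consecutive rows of the staircase matrix differ by an index shift of 2. Multiplying by
  an even series therefore adds multiples of later rows to each row.\<close>

lemma jacobi_trudi_staircase_mult_even:
  assumes odd: "\<And>n. odd n \<Longrightarrow> fps_nth G n = 0" and G0: "fps_nth G 0 = 1"
  shows "jacobi_trudi N (staircase_fun N) (F * G) = jacobi_trudi N (staircase_fun N) F"
  unfolding jacobi_trudi_staircase
proof (rule det_mat_unitriangular_left[where a = "\<lambda>i k. if k < i then 0 else fps_nth G (2 * (k - i))"])
  fix i j assume ij: "i < N" "j < N"
  let ?f = "\<lambda>n. fps_nth_int F n" and ?n = "int N - 2 * int i + int j"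
  \<comment> \<open>As \<open>j < N\<close>, the index \<open>?n\<close> is below
    \<open>2 * (N - i)\<close>, so all terms come from rows \<open>i\<close> to
    \<open>N - 1\<close>.\<close>
  have "fps_nth_int (F * G) ?n = (\<Sum>k<2 * (N - i). fps_nth G k * ?f (?n - int k))"
    by (rule fps_nth_int_mult) (use ij in auto)
  also have "\<dots> = (\<Sum>k<N - i. fps_nth G (2 * k) * ?f (int N - 2 * int (k + i) + int j))"
    unfolding sum_lessThan_double diff_mult_distrib2[symmetric]
    by (intro sum.cong refl) (simp add: odd algebra_simps)
  also have "\<dots> = (\<Sum>k=i..<N. fps_nth G (2 * (k - i)) * ?f (int N - 2 * int k + int j))"
    by (rule sum.reindex_bij_witness[where i = "\<lambda>k. k - i" and j = "\<lambda>k. k + i"]) auto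
  also have "\<dots> = (\<Sum>k<N. (if k < i then 0 else fps_nth G (2 * (k - i))) * ?f (int N - 2 * int k + int j))"
    by (rule sum.mono_neutral_cong_left) auto
  finally show "fps_nth_int (F * G) ?n = \<dots>" .
qed (use G0 in auto)

lemma jacobi_trudi_staircase_arctanh_series:
  "jacobi_trudi N (staircase_fun N) (arctanh_series a u) = jacobi_trudi N (staircase_fun N) (fps_binomial u)"
proof -
  \<comment> \<open>\<open>G\<close> is \<open>(1 - z^2)^b\<close>, and this \<open>b\<close> turns
    the exponents \<open>a + u / 2\<close> and \<open>a - u / 2\<close> into \<open>u\<close> and
    0.\<close>
  define b where "b = u / 2 - a"
  define G where "G = fps_binomial b * fps_flip (fps_binomial b)"
  have one: "fps_flip (fps_binomial (a - u / 2)) * fps_flip (fps_binomial b) = 1"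
    using arctanh_series_0_0
    by (simp add: arctanh_series_def b_def flip: fps_flip_mult fps_binomial_add_mult)
  have "arctanh_series a u * G = fps_binomial (a + u / 2) * fps_binomial b *
      (fps_flip (fps_binomial (a - u / 2)) * fps_flip (fps_binomial b))"
    by (simp add: arctanh_series_def G_def mult_ac)
  also have "\<dots> = fps_binomial u"
    unfolding one by (simp add: b_def flip: fps_binomial_add_mult)
  finally have eq: "fps_binomial u = arctanh_series a u * G" ..
  have "fps_flip G = G" by (simp add: G_def fps_flip_mult mult.commute)
  then have "(-1) ^ n * fps_nth G n = fps_nth G n" for n
    by (metis fps_flip_def fps_nth_Abs_fps)
  then have "fps_nth G n = 0" if "odd n" for n
    using that by (metis add.inverse_inverse equal_neg_zero mult_minus1 power_minus_odd power_one)
  moreover have "fps_nth G 0 = 1" by (simp add: G_def fps_flip_def)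
  ultimately show ?thesis
    unfolding eq by (rule jacobi_trudi_staircase_mult_even[symmetric])
qed

text \<open>By Vandermonde's identity, column \<open>j\<close> for the parameter
  \<open>c + j\<close> is a unitriangular combination of the columns for \<open>c\<close>. The shift
  prepares the common factors in \<open>jacobi_trudi_staircase_of_nat\<close>.\<close>

lemma jacobi_trudi_staircase_fps_binomial_shifted:
  "jacobi_trudi N (staircase_fun N) (fps_binomial c) =
     det (mat N N (\<lambda>(i, j). fps_nth_int (fps_binomial (c + real j)) (int N - 2 * int i + int j)))"
  unfolding jacobi_trudi_staircase
proof (rule det_mat_unitriangular_right[where a = "\<lambda>k j. real (j choose k)", symmetric])
  fix i j assume "i < N" "j < N"
  let ?n = "int N - 2 * int i"
  have "fps_nth_int (fps_binomial (c + real j)) (?n + int j) =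
    (\<Sum>k<Suc j. real (j choose k) * fps_nth_int (fps_binomial c) (?n + int j - int k))"
    unfolding fps_binomial_add_mult
    by (subst fps_nth_int_mult[where K = "Suc j"]) (auto simp: binomial_gbinomial[symmetric] binomial_eq_0)
  also have "\<dots> = (\<Sum>k<Suc j. fps_nth_int (fps_binomial c) (?n + int k) * real (j choose k))"
    by (rule sum.reindex_bij_witness[where i = "\<lambda>k. j - k" and j = "\<lambda>k. j - k"])
       (auto simp: binomial_symmetric[symmetric] of_nat_diff algebra_simps)
  also have "\<dots> = (\<Sum>k<N. fps_nth_int (fps_binomial c) (?n + int k) * real (j choose k))"
    using \<open>j < N\<close> by (intro sum.mono_neutral_left) (auto simp: binomial_eq_0)
  finally show "fps_nth_int (fps_binomial (c + real j)) (?n + int j) = \<dots>" .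
qed (auto simp: binomial_eq_0)

section \<open>Binomial determinants as content products\<close>

lemma det_mat_scale:
  "det (mat N N (\<lambda>(i, j). r i * c j * f i j)) =
     (\<Prod>i<N. r i) * (\<Prod>j<N. c j) * det (mat N N (\<lambda>(i, j). f i j))"
proof -
  have "(\<Prod>i=0..<N. c (p i)) = (\<Prod>i=0..<N. c i)" if "p permutes {0..<N}" for p
    using prod.permute[OF that, of c] by (simp add: comp_def)
  then show ?thesis
    by (auto simp: det_mat_leibniz prod.distrib sum_distrib_left lessThan_atLeast0 mult_ac intro!: sum.cong)
qed

text \<open>\<open>j\<close> runs over the columns of the staircase and \<open>r\<close> over the
  rows meeting column \<open>j\<close>, so each factor is \<open>u\<close> plus a content.\<close>

definition content_product :: "nat \<Rightarrow> real \<Rightarrow> real" where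
  "content_product N u = (\<Prod>j<N. \<Prod>r<N - j. u + real j - real r)"

lemma prod_falling_eq_fact_divide:
  "k \<le> x \<Longrightarrow> (\<Prod>r<k. real x - real r) = fact x / fact (x - k)"
proof (induction k)
  case (Suc k)
  then have "x - k = Suc (x - Suc k)" by simp
  then have "fact (x - k) = (real x - real k) * fact (x - Suc k)"
    using Suc.prems by (simp add: of_nat_diff)
  with Suc show ?case by (simp add: field_simps)
qed simp

text \<open>Column by column the factors form falling factorials; \<open>N \<le> t\<close> keeps the
  subtraction \<open>t + 2 * i - N\<close> exact.\<close>

lemma content_product_of_nat:
  assumes "N \<le> t"
  shows "content_product N (real t) = (\<Prod>i<N. 1 / fact (t + 2 * i - N)) * (\<Prod>j<N. fact (t + j))"
  unfolding content_product_def prod.distrib[symmetric]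
proof (rule prod.cong[OF refl])
  fix j assume "j \<in> {..<N}"
  then have "t + j - (N - j) = t + 2 * j - N" "N - j \<le> t + j" using assms by auto
  then show "(\<Prod>r<N - j. real t + real j - real r) = 1 / fact (t + 2 * j - N) * fact (t + j)"
    using prod_falling_eq_fact_divide[of "N - j" "t + j"] by simp
qed

text \<open>With \<open>s = N - 2 * i + j\<close>, the entry \<open>t + j choose s\<close> is
  \<open>1 / s!\<close> times a column factor \<open>(t + j)!\<close> and a row factor
  \<open>1 / (t + 2 * i - N)!\<close>, because \<open>t + j - s\<close> does not depend on
  \<open>j\<close>. The numbers \<open>1 / s!\<close> are the coefficients of
  \<open>fps_exp 1\<close>.\<close>

lemma jacobi_trudi_staircase_of_nat:
  assumes "N \<le> t"
  shows "jacobi_trudi N (staircase_fun N) (fps_binomial (real t)) =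
    content_product N (real t) * jacobi_trudi N (staircase_fun N) (fps_exp 1)"
proof -
  have entry: "fps_nth_int (fps_binomial (real t + real j)) (int N - 2 * int i + int j) =
     1 / fact (t + 2 * i - N) * fact (t + j) * fps_nth_int (fps_exp 1) (int N - 2 * int i + int j)"
    if "i < N" "j < N" for i j
  proof (cases "int N - 2 * int i + int j < 0")
    case False
    define s where "s = nat (int N - 2 * int i + int j)"
    have s: "s \<le> t + j" "t + j - s = t + 2 * i - N" using False assms by (auto simp: s_def)
    have "real (t + j choose s) = fact (t + j) / (fact s * fact (t + j - s))"
      using s(1) by (rule binomial_fact)
    with s False show ?thesis
      by (simp add: fps_nth_int_def binomial_gbinomial flip: s_def)
  qed (simp add: fps_nth_int_def)
  have "jacobi_trudi N (staircase_fun N) (fps_binomial (real t)) =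
    det (mat N N (\<lambda>(i, j). 1 / fact (t + 2 * i - N) * fact (t + j) *
       fps_nth_int (fps_exp 1) (int N - 2 * int i + int j)))"
    unfolding jacobi_trudi_staircase_fps_binomial_shifted
    by (intro arg_cong[of _ _ det] cong_mat) (simp_all add: entry)
  then show ?thesis
    by (simp only: det_mat_scale content_product_of_nat[OF assms] jacobi_trudi_staircase)
qed

text \<open>At \<open>u = N + 1\<close> the first row is a unit vector; this determines the constant factor of the
  determinant by recursion.\<close>

lemma jacobi_trudi_staircase_Suc:
  "jacobi_trudi (Suc N) (staircase_fun (Suc N)) (fps_binomial (real (Suc N))) =
   jacobi_trudi N (staircase_fun N) (fps_binomial (real (Suc N)))"
proof -
  let ?A = "mat (Suc N) (Suc N) (\<lambda>(i, j). fps_nth_int (fps_binomial (real (Suc N))) (int (Suc N) - 2 * int i + int j))"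
  have row0: "?A $$ (0, j) = (if j = 0 then 1 else 0)" if "j < Suc N" for j
  proof -
    have "nat (int (Suc N) + int j) = Suc N + j" by simp
    then have "?A $$ (0, j) = real (Suc N choose (Suc N + j))"
      using that by (simp add: fps_nth_int_def binomial_gbinomial del: of_nat_Suc binomial_Suc_Suc)
    then show ?thesis by (auto simp: binomial_eq_0)
  qed
  have "det ?A = (\<Sum>j<Suc N. ?A $$ (0, j) * cofactor ?A 0 j)"
    by (rule laplace_expansion_row) auto
  also have "\<dots> = (\<Sum>j<Suc N. if j = 0 then cofactor ?A 0 j else 0)"
  proof (rule sum.cong[OF refl])
    fix j assume "j \<in> {..<Suc N}"
    then have "?A $$ (0, j) = (if j = 0 then 1 else 0)" by (intro row0) simp
    then show "?A $$ (0, j) * cofactor ?A 0 j = (if j = 0 then cofactor ?A 0 j else 0)"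
      by (simp only: if_distrib[of "\<lambda>x. x * _"]) simp
  qed
  also have "\<dots> = det (mat_delete ?A 0 0)"
    by (simp add: sum.delta cofactor_def)
  \<comment> \<open>Passing to row \<open>i + 1\<close> and column \<open>j + 1\<close> changes the
    index by -2 + 1, which turns \<open>Suc N\<close> into \<open>N\<close>.\<close>
  also have "mat_delete ?A 0 0 = mat N N (\<lambda>(i, j). fps_nth_int (fps_binomial (real (Suc N))) (int N - 2 * int i + int j))"
    by (rule eq_matI) (auto simp: mat_delete_def algebra_simps)
  finally show ?thesis unfolding jacobi_trudi_staircase .
qed

text \<open>Every column gains a cell at its foot, and column \<open>N\<close> is new; the added
  cell of column \<open>j\<close> lies in row \<open>N - j\<close> and has content
  \<open>2 * j - N\<close>.\<close>

lemma content_product_Suc: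
  "content_product (Suc N) u = content_product N u * (\<Prod>j<Suc N. u + 2 * real j - real N)"
proof -
  have "content_product (Suc N) u = (\<Prod>j<Suc N. (\<Prod>r<N - j. u + real j - real r) * (u + 2 * real j - real N))"
    unfolding content_product_def
    by (intro prod.cong refl) (auto simp: Suc_diff_le of_nat_diff algebra_simps less_Suc_eq_le)
  then show ?thesis by (simp add: prod.distrib content_product_def)
qed

lemma content_product_pos: "N \<le> t \<Longrightarrow> content_product N (real t) > 0"
  by (simp add: content_product_of_nat prod_pos)

definition odd_hook_product :: "nat \<Rightarrow> nat" where
  "odd_hook_product N = (\<Prod>i=1..N. (2 * i - 1) ^ (Suc N - i))"

lemma odd_hook_product_Suc: "odd_hook_product (Suc N) = odd_hook_product N * (\<Prod>j<Suc N. 2 * j + 1)"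
proof -
  have "odd_hook_product (Suc N) = (\<Prod>i=1..Suc N. (2 * i - 1) ^ (Suc N - i) * (2 * i - 1))"
    unfolding odd_hook_product_def by (intro prod.cong refl) (auto simp: Suc_diff_le)
  also have "\<dots> = (\<Prod>i=1..Suc N. (2 * i - 1) ^ (Suc N - i)) * (\<Prod>i=1..Suc N. 2 * i - 1)"
    by (rule prod.distrib)
  also have "(\<Prod>i=1..Suc N. (2 * i - 1) ^ (Suc N - i)) = odd_hook_product N"
    by (simp add: odd_hook_product_def)
  also have "(\<Prod>i=1..Suc N. 2 * i - 1) = (\<Prod>j<Suc N. 2 * j + (1::nat))"
    by (rule prod.reindex_bij_witness[where i = Suc and j = "\<lambda>i. i - 1"]) auto
  finally show ?thesis .
qed

text \<open>At \<open>u = N + 1\<close> the determinants of orders \<open>N + 1\<close> and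
  \<open>N\<close> agree while the content products differ by the factors \<open>2 * j + 1\<close>,
  the same odd numbers that \<open>odd_hook_product\<close> acquires.\<close>

lemma jacobi_trudi_staircase_fps_exp:
  "jacobi_trudi N (staircase_fun N) (fps_exp 1) * real (odd_hook_product N) = 1"
proof (induction N)
  case 0
  show ?case by (simp add: jacobi_trudi_def odd_hook_product_def)
next
  case (Suc N)
  let ?C = "\<lambda>N. jacobi_trudi N (staircase_fun N) (fps_exp 1)"
  let ?h = "\<Prod>j<Suc N. 2 * real j + 1"
  have "content_product (Suc N) (real (Suc N)) * ?C (Suc N) = content_product N (real (Suc N)) * ?C N"
    using jacobi_trudi_staircase_Suc[of N] jacobi_trudi_staircase_of_nat[of "Suc N" "Suc N"]
      jacobi_trudi_staircase_of_nat[of N "Suc N"] by simp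
  moreover have "content_product (Suc N) (real (Suc N)) = content_product N (real (Suc N)) * ?h"
    unfolding content_product_Suc by (simp add: algebra_simps)
  ultimately have "?h * ?C (Suc N) = ?C N"
    using content_product_pos[of N "Suc N"] by simp
  moreover have "real (odd_hook_product (Suc N)) = real (odd_hook_product N) * ?h"
    by (simp only: odd_hook_product_Suc of_nat_mult of_nat_prod of_nat_add of_nat_numeral of_nat_1)
  ultimately show ?case using Suc by (simp add: mult_ac)
qed

definition content_poly :: "nat \<Rightarrow> real poly" where
  "content_poly N = (\<Prod>j<N. \<Prod>r<N - j. [:real j - real r, 1:])"

lemma poly_content_poly: "poly (content_poly N) u = content_product N u"
  by (simp add: content_poly_def content_product_def poly_prod algebra_simps)

text \<open>For every \<open>a\<close>, the two polynomials agree at all natural numbers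
  \<open>t \<ge> N\<close>, hence are equal.\<close>

lemma jacobi_trudi_poly_staircase:
  "Polynomial.smult (real (odd_hook_product N)) (jacobi_trudi_poly N (staircase_fun N) (arctanh_poly a)) = content_poly N"
  (is "?p = ?q")
proof (rule ccontr)
  assume "?p \<noteq> ?q"
  then have "finite {x. poly (?p - ?q) x = 0}" by (intro poly_roots_finite) simp
  moreover have "poly (?p - ?q) (real t) = 0" if "N \<le> t" for t
  proof -
    have "poly ?p (real t) = real (odd_hook_product N) * jacobi_trudi N (staircase_fun N) (fps_binomial (real t))"
      by (simp add: poly_jacobi_trudi_poly[OF poly_arctanh_poly] jacobi_trudi_staircase_arctanh_series)
    also have "\<dots> = content_product N (real t)"
      using jacobi_trudi_staircase_fps_exp[of N]
      by (simp add: jacobi_trudi_staircase_of_nat[OF that] mult_ac)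
    finally show ?thesis by (simp add: poly_content_poly)
  qed
  then have "real ` {N..} \<subseteq> {x. poly (?p - ?q) x = 0}" by auto
  ultimately have "finite (real ` {N..})" by (rule rev_finite_subset)
  then have "finite {N..}" by (rule finite_imageD) (simp add: inj_on_def)
  then show False by (simp add: infinite_Ici)
qed

section \<open>From contents to the umbral expression\<close>

text \<open>Expresses \<open>p (\<i> x) = \<i>^n q x\<close> coefficientwise.\<close>

definition umbral_twist :: "nat \<Rightarrow> real poly \<Rightarrow> real poly \<Rightarrow> bool" where
  "umbral_twist n p q \<longleftrightarrow> (\<forall>d. \<i> ^ d * complex_of_real (coeff p d) = \<i> ^ n * complex_of_real (coeff q d))"

lemma umbral_twist_mult:
  assumes "umbral_twist n p q" "umbral_twist n' p' q'"
  shows "umbral_twist (n + n') (p * p') (q * q')"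
  unfolding umbral_twist_def
proof
  fix d
  have "\<i> ^ d * complex_of_real (coeff (p * p') d) =
     (\<Sum>k\<le>d. (\<i> ^ k * complex_of_real (coeff p k)) * (\<i> ^ (d - k) * complex_of_real (coeff p' (d - k))))"
    unfolding coeff_mult of_real_sum sum_distrib_left
    by (intro sum.cong refl) (simp add: mult_ac flip: power_add)
  also have "\<dots> = (\<Sum>k\<le>d. (\<i> ^ n * complex_of_real (coeff q k)) * (\<i> ^ n' * complex_of_real (coeff q' (d - k))))"
    using assms by (simp add: umbral_twist_def)
  also have "\<dots> = \<i> ^ (n + n') * complex_of_real (coeff (q * q') d)"
    by (simp add: coeff_mult sum_distrib_left power_add mult_ac)
  finally show "\<i> ^ d * complex_of_real (coeff (p * p') d) = \<i> ^ (n + n') * complex_of_real (coeff (q * q') d)" .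
qed

lemma umbral_twist_1: "umbral_twist 0 1 1"
  by (auto simp: umbral_twist_def coeff_1 intro!: gr0I)

lemma umbral_twist_power: "umbral_twist n p q \<Longrightarrow> umbral_twist (k * n) (p ^ k) (q ^ k)"
  by (induction k) (auto intro: umbral_twist_mult umbral_twist_1)

lemma umbral_twist_prod:
  assumes "\<And>j. j \<in> J \<Longrightarrow> umbral_twist (n j) (p j) (q j)"
  shows "umbral_twist (\<Sum>j\<in>J. n j) (\<Prod>j\<in>J. p j) (\<Prod>j\<in>J. q j)"
  using assms
  by (induction J rule: infinite_finite_induct) (auto intro: umbral_twist_mult umbral_twist_1)

lemma umbral_twist_E: "umbral_twist 1 umbral_E umbral_E"
  by (auto simp: umbral_twist_def coeff_pCons split: nat.split)

text \<open>Since \<open>(\<i> x)^2 - c = \<i>^2 (x^2 + c)\<close>, the twist turns the factors from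
  opposite contents into those of the umbral formula.\<close>

lemma umbral_twist_E_squared: "umbral_twist 2 (umbral_E ^ 2 + [:- c:]) (umbral_E ^ 2 + [:c:])"
  by (auto simp: umbral_twist_def coeff_pCons power2_eq_square split: nat.split)

text \<open>\<open>\<i> ^ d\<close> is \<open>(-1) ^ (d div 2)\<close>, times \<open>\<i>\<close>
  for odd \<open>d\<close>; so the twist trades the signs in the functional for one global
  sign.\<close>

lemma signed_umbral_eval_twist:
  assumes "umbral_twist n p q"
  shows "signed_umbral_eval p = (-1) ^ (n div 2) * umbral_eval q"
proof -
  have i_pow: "\<i> ^ d = (-1) ^ (d div 2) * \<i> ^ (d mod 2)" for d
  proof -
    have "\<i> ^ d = \<i> ^ (2 * (d div 2) + d mod 2)" by simp
    then show ?thesis unfolding power_add power_mult by simp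
  qed
  have coeff: "(-1) ^ (d div 2) * coeff p d = (-1) ^ (n div 2) * coeff q d" for d
  proof -
    have "\<i> ^ d * complex_of_real (coeff p d) = \<i> ^ n * complex_of_real (coeff q d)"
      using assms by (simp add: umbral_twist_def)
    then have "complex_of_real ((-1) ^ (d div 2) * coeff p d) * \<i> ^ (d mod 2) =
        complex_of_real ((-1) ^ (n div 2) * coeff q d) * \<i> ^ (n mod 2)"
      unfolding i_pow[of d] i_pow[of n] of_real_mult of_real_power of_real_minus of_real_1
      by (simp only: mult.assoc mult.commute[of "\<i> ^ _"])
    \<comment> \<open>If \<open>d\<close> and \<open>n\<close> differ in parity, one side is real
      and the other purely imaginary, so both coefficients vanish.\<close>
    then show ?thesis
      using mod_2_eq_odd[of d] mod_2_eq_odd[of n]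
      by (cases "even d"; cases "even n") (simp_all only: complex_eq_iff, simp_all)
  qed
  have "umbral_eval q = (\<Sum>i\<le>max (degree p) (degree q). coeff q i * euler_number i)"
    unfolding umbral_eval_def by (rule sum.mono_neutral_left) (auto simp: coeff_eq_0)
  moreover have "signed_umbral_eval p = (\<Sum>i\<le>max (degree p) (degree q). (-1) ^ (i div 2) * coeff p i * euler_number i)"
    by (subst signed_umbral_eval_eq[of _ "max (degree p) (degree q)"]) (auto simp: mult_ac)
  ultimately show ?thesis
    by (simp add: coeff sum_distrib_left mult.assoc)
qed

text \<open>Cells are split into those on the diagonal and those on either side. For
  \<open>d > 0\<close> there are \<open>(Suc N - d) div 2\<close> cells of content \<open>d\<close>
  and as many of content \<open>- d\<close>; their factors pair up to
  \<open>E^2 - d^2\<close>.\<close>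

lemma content_poly_factorization:
  "content_poly N = umbral_E ^ (Suc N div 2) *
     (\<Prod>d=1..N - 1. (umbral_E ^ 2 + [:- (real d)\<^sup>2:]) ^ ((Suc N - d) div 2))"
proof -
  let ?f = "\<lambda>(j, r). [:real j - real r, 1:]"
  let ?C = "\<lambda>P. {(j, r). j + r < N \<and> P j r}"
  let ?S = "Sigma {1..N - 1} (\<lambda>d. {..<(Suc N - d) div 2})"
  have fin: "finite (?C P)" for P
    by (rule finite_subset[of _ "{..<N} \<times> {..<N}"]) auto
  have "content_poly N = prod ?f (Sigma {..<N} (\<lambda>j. {..<N - j}))"
    unfolding content_poly_def by (rule prod.Sigma) auto
  also have "Sigma {..<N} (\<lambda>j. {..<N - j}) = ?C (=) \<union> (?C (<) \<union> ?C (>))" by auto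
  also have "prod ?f \<dots> = prod ?f (?C (=)) * (prod ?f (?C (<)) * prod ?f (?C (>)))"
    using fin by (subst prod.union_disjoint; auto)+
  also have "prod ?f (?C (=)) = (\<Prod>a<Suc N div 2. umbral_E)"
    by (rule prod.reindex_bij_witness[where i = "\<lambda>a. (a, a)" and j = fst]) auto
  also have "prod ?f (?C (<)) = (\<Prod>(d, a)\<in>?S. [:- real d, 1:])"
    by (rule prod.reindex_bij_witness[where i = "\<lambda>(d, a). (a, a + d)" and j = "\<lambda>(j, r). (r - j, j)"]) auto
  also have "prod ?f (?C (>)) = (\<Prod>(d, a)\<in>?S. [:real d, 1:])"
    by (rule prod.reindex_bij_witness[where i = "\<lambda>(d, a). (a + d, a)" and j = "\<lambda>(j, r). (j - r, r)"]) auto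
  also have "(\<Prod>(d, a)\<in>?S. [:- real d, 1:]) * (\<Prod>(d, a)\<in>?S. [:real d, 1:]) =
      (\<Prod>(d, a)\<in>?S. umbral_E ^ 2 + [:- (real d)\<^sup>2:])"
    unfolding prod.distrib[symmetric] by (intro prod.cong) (auto simp: power2_eq_square)
  also have "\<dots> = (\<Prod>d=1..N - 1. \<Prod>a<(Suc N - d) div 2. umbral_E ^ 2 + [:- (real d)\<^sup>2:])"
    by (rule prod.Sigma[symmetric]) auto
  finally show ?thesis by simp
qed

text \<open>The exponent of the twist equals the degree of \<open>content_poly N\<close>, the number
  of cells; this brings the sign into the form used in \<open>signed_zigzag_count\<close>.\<close>

lemma signed_umbral_eval_content_poly:
  "signed_umbral_eval (content_poly N) = (-1) ^ ((\<Sum>i<N. N - i) div 2) *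
     umbral_eval (umbral_E ^ (Suc N div 2) *
       (\<Prod>d=1..N - 1. (umbral_E ^ 2 + [:(real d)\<^sup>2:]) ^ ((Suc N - d) div 2)))"
proof -
  let ?n = "Suc N div 2 * 1 + (\<Sum>d=1..N - 1. (Suc N - d) div 2 * 2)"
  have tw: "umbral_twist ?n (content_poly N) (umbral_E ^ (Suc N div 2) *
       (\<Prod>d=1..N - 1. (umbral_E ^ 2 + [:(real d)\<^sup>2:]) ^ ((Suc N - d) div 2)))"
    unfolding content_poly_factorization
    by (intro umbral_twist_mult umbral_twist_prod umbral_twist_power umbral_twist_E umbral_twist_E_squared)
  have "degree (content_poly N) = (\<Sum>j<N. N - j)"
    unfolding content_poly_def by (subst degree_prod_eq_sum_degree) (auto simp: degree_prod_eq_sum_degree)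
  moreover have "degree (content_poly N) = ?n"
  proof -
    have ne: "umbral_E ^ 2 + [:- (real d)\<^sup>2:] \<noteq> 0" "degree (umbral_E ^ 2 + [:- (real d)\<^sup>2:]) = 2" for d
      by (auto simp: power2_eq_square)
    show ?thesis
      unfolding content_poly_factorization
      using ne by (subst degree_mult_eq) (auto simp: degree_power_eq degree_prod_eq_sum_degree)
  qed
  ultimately show ?thesis using signed_umbral_eval_twist[OF tw] by simp
qed

section \<open>Tableaux as ballot words\<close>

lemma all_nat_iff: "(\<forall>k. P k) \<longleftrightarrow> P 0 \<and> (\<forall>k. P (Suc k))" for P :: "nat \<Rightarrow> bool"
  by (metis not0_implies_Suc)

lemma zigzag_iff:
  "zigzag w \<longleftrightarrow> (\<forall>k. Suc k < length w \<longrightarrow> (w ! Suc k < w ! k \<longleftrightarrow> odd k))"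
proof (induction w rule: zigzag.induct)
  case (3 x y w)
  have "(\<forall>k. Suc k < length (x # y # w) \<longrightarrow> ((x # y # w) ! Suc k < (x # y # w) ! k \<longleftrightarrow> odd k)) \<longleftrightarrow>
     \<not> y < x \<and> (w \<noteq> [] \<longrightarrow> w ! 0 < y) \<and> (\<forall>k. Suc k < length w \<longrightarrow> (w ! Suc k < w ! k \<longleftrightarrow> odd k))"
    by (subst all_nat_iff, subst all_nat_iff) simp
  with 3 show ?case by (auto simp: hd_conv_nth)
qed auto

lemma ballot_iff:
  "ballot w \<longleftrightarrow> (\<forall>k i. count_list (drop k w) (Suc i) \<le> count_list (drop k w) i)"
proof (induction w)
  case (Cons r w)
  have "(\<forall>k i. count_list (drop k (r # w)) (Suc i) \<le> count_list (drop k (r # w)) i) \<longleftrightarrow>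
     (\<forall>i. count_list (r # w) (Suc i) \<le> count_list (r # w) i) \<and> ballot w"
    using Cons.IH by (subst all_nat_iff) simp
  moreover have "(\<forall>i. count_list (r # w) (Suc i) \<le> count_list (r # w) i) \<longleftrightarrow>
     r = 0 \<or> count_list w r < count_list w (r - 1)" if "ballot w"
  proof (cases r)
    case 0
    then show ?thesis using ballot_count_list_le[OF that] by (auto simp: le_Suc_eq)
  next
    case (Suc q)
    then show ?thesis using ballot_count_list_le[OF that] by (auto simp: Suc_le_eq le_Suc_eq)
  qed
  ultimately show ?case unfolding ballot.simps by blast
qed simp

text \<open>With the next lemma, this translates comparisons between entries of adjacent rows into
  comparisons of counts, as needed to build a tableau from a ballot word.\<close>

lemma sorted_list_of_set_nth_le:
  fixes S :: "nat set"
  assumes "finite S" "j < card {a \<in> S. a \<le> b}"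
  shows "sorted_list_of_set S ! j \<le> b"
proof (rule ccontr)
  let ?l = "sorted_list_of_set S"
  assume "\<not> ?l ! j \<le> b"
  have "{a \<in> S. a \<le> b} \<subseteq> (!) ?l ` {..<j}"
  proof
    fix a assume a: "a \<in> {a \<in> S. a \<le> b}"
    then obtain k where k: "k < length ?l" "?l ! k = a"
      using assms(1) by (metis (lifting) in_set_conv_nth mem_Collect_eq set_sorted_list_of_set)
    have "\<not> j \<le> k"
      using k a \<open>\<not> ?l ! j \<le> b\<close> sorted_nth_mono[OF sorted_sorted_list_of_set[of S], of j k] by auto
    then show "a \<in> (!) ?l ` {..<j}" using k by auto
  qed
  then have "card {a \<in> S. a \<le> b} \<le> card ((!) ?l ` {..<j})" by (intro card_mono) auto
  also have "\<dots> \<le> j" using card_image_le[of "{..<j}" "(!) ?l"] by simp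
  finally show False using assms by simp
qed

lemma card_le_sorted_list_of_set_nth:
  fixes S :: "nat set"
  assumes "finite S" "j < card S"
  shows "j < card {a \<in> S. a \<le> sorted_list_of_set S ! j}"
proof -
  let ?l = "sorted_list_of_set S"
  have len: "length ?l = card S" by simp
  have "(!) ?l ` {..j} \<subseteq> {a \<in> S. a \<le> ?l ! j}"
  proof
    fix a assume "a \<in> (!) ?l ` {..j}"
    then obtain k where k: "k \<le> j" "a = ?l ! k" by auto
    have "a \<in> set ?l" unfolding k(2) by (rule nth_mem) (use k assms len in simp)
    moreover have "a \<le> ?l ! j" unfolding k(2) by (rule sorted_nth_mono) (use k assms len in auto)
    ultimately show "a \<in> {a \<in> S. a \<le> ?l ! j}" using assms(1) by simp
  qed
  then have "card ((!) ?l ` {..j}) \<le> card {a \<in> S. a \<le> ?l ! j}"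
    using assms(1) by (intro card_mono) auto
  moreover have "card ((!) ?l ` {..j}) = Suc j"
  proof (subst card_image)
    show "inj_on ((!) ?l) {..j}"
      using assms len by (intro inj_on_nth) auto
  qed simp
  ultimately show ?thesis by simp
qed

lemma strict_mono_on_image_eq_imp_eq:
  fixes g h :: "nat \<Rightarrow> nat"
  assumes "\<And>j j'. j < j' \<Longrightarrow> j' < m \<Longrightarrow> g j < g j'" "\<And>j j'. j < j' \<Longrightarrow> j' < m \<Longrightarrow> h j < h j'"
    and "g ` {..<m} = h ` {..<m}" and "j < m"
  shows "g j = h j"
proof -
  have "sorted_wrt (<) (map g [0..<m])" "sorted_wrt (<) (map h [0..<m])"
    using assms(1,2) by (auto simp: sorted_wrt_iff_nth_less)
  moreover have "set (map g [0..<m]) = set (map h [0..<m])"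
    using assms(3) by (simp add: lessThan_atLeast0)
  ultimately have "map g [0..<m] = map h [0..<m]"
    by (intro strict_sorted_equal)
  then show ?thesis using assms(4) by (simp add: map_eq_conv)
qed

text \<open>Links the list of parts with the zero-padded function \<open>f\<close> used for words
  and determinants.\<close>

locale partition_shape =
  fixes lam :: "nat list" and f :: "nat \<Rightarrow> nat" and N :: nat
  assumes diagram: "young_diagram lam = {(i, j). j < f i}"
    and partition: "f \<in> partitions_upto N"
    and size: "sum_list lam = (\<Sum>i<N. f i)"
begin

abbreviation "n \<equiv> sum_list lam"
abbreviation "Y \<equiv> young_diagram lam"

lemma f_antimono: "i \<le> i' \<Longrightarrow> f i' \<le> f i"
  using partition lift_Suc_antimono_le[of f i i'] by (auto simp: partitions_upto_def)

section \<open>The row word of a tableau\<close>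

definition row_of :: "(nat \<times> nat \<Rightarrow> nat) \<Rightarrow> nat \<Rightarrow> nat" where
  "row_of T a = fst (inv_into Y T a)"

definition row_word :: "(nat \<times> nat \<Rightarrow> nat) \<Rightarrow> nat list" where
  "row_word T = map (row_of T) (rev [1..<Suc n])"

lemma length_row_word [simp]: "length (row_word T) = n"
  by (simp add: row_word_def del: upt_Suc)

lemma nth_row_word: "k < n \<Longrightarrow> row_word T ! k = row_of T (n - k)"
  by (simp add: row_word_def rev_nth Suc_diff_Suc del: upt_Suc)

lemma drop_row_word: "drop k (row_word T) = map (row_of T) (rev [1..<Suc (n - k)])"
  by (cases "k \<le> n") (simp_all add: row_word_def drop_map drop_rev take_upt Suc_diff_le del: upt_Suc)

lemma count_list_drop_row_word:
  "count_list (drop k (row_word T)) i = card {a \<in> {1..n - k}. row_of T a = i}"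
proof -
  have "count_list (drop k (row_word T)) i = length (filter (\<lambda>a. row_of T a = i) (rev [1..<Suc (n - k)]))"
    unfolding drop_row_word count_list_eq_length_filter by (simp add: filter_map comp_def eq_commute[of i] del: upt_Suc)
  also have "\<dots> = card (set (filter (\<lambda>a. row_of T a = i) (rev [1..<Suc (n - k)])))"
    by (rule distinct_card[symmetric]) simp
  also have "set (filter (\<lambda>a. row_of T a = i) (rev [1..<Suc (n - k)])) = {a \<in> {1..n - k}. row_of T a = i}"
    by auto
  finally show ?thesis .
qed

context
  fixes T assumes T: "T \<in> standard_tableaux lam"
begin

lemma T_bij: "bij_betw T Y {1..n}"
  using T by (simp add: standard_tableaux_def)

lemma T_row: "j < j' \<Longrightarrow> j' < f i \<Longrightarrow> T (i, j) < T (i, j')"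
  using T by (simp add: standard_tableaux_def diagram)

lemma T_col: "i < i' \<Longrightarrow> j < f i' \<Longrightarrow> T (i, j) < T (i', j)"
  using T f_antimono[of i i'] by (auto simp: standard_tableaux_def diagram)

lemma row_of_T: "j < f i \<Longrightarrow> row_of T (T (i, j)) = i"
  using T_bij by (simp add: row_of_def bij_betw_def inv_into_f_f diagram)

lemma T_in_range: "j < f i \<Longrightarrow> T (i, j) \<in> {1..n}"
  using T_bij diagram by (auto simp: bij_betw_def)

lemma T_surj: "a \<in> {1..n} \<Longrightarrow> \<exists>j < f (row_of T a). T (row_of T a, j) = a"
proof -
  assume "a \<in> {1..n}"
  then have "a \<in> T ` Y" using T_bij by (simp only: bij_betw_def)
  then obtain i j where ij: "j < f i" "a = T (i, j)" unfolding diagram by auto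
  then have "row_of T a = i" using row_of_T by simp
  with ij show ?thesis by auto
qed

lemma row_eq_image: "{a \<in> {1..n}. row_of T a = i} = (\<lambda>j. T (i, j)) ` {..<f i}"
proof (intro subset_antisym subsetI)
  fix a assume "a \<in> {a \<in> {1..n}. row_of T a = i}"
  then show "a \<in> (\<lambda>j. T (i, j)) ` {..<f i}" using T_surj[of a] by auto
next
  fix a assume "a \<in> (\<lambda>j. T (i, j)) ` {..<f i}"
  then show "a \<in> {a \<in> {1..n}. row_of T a = i}" using T_in_range row_of_T by auto
qed

lemma row_inj: "inj_on (\<lambda>j. T (i, j)) {..<f i}"
  by (rule inj_onI) (metis T_row lessThan_iff less_irrefl linorder_neqE_nat)

lemma count_list_row_word: "count_list (row_word T) = f"
proof
  fix i
  show "count_list (row_word T) i = f i"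
    using count_list_drop_row_word[of 0 T i] card_image[OF row_inj, of i] row_eq_image[of i] by simp
qed

text \<open>Among the entries up to \<open>n - k\<close>, each one in row \<open>Suc i\<close> has a
  smaller one directly above it in row \<open>i\<close>, by column strictness.\<close>

lemma ballot_row_word: "ballot (row_word T)"
  unfolding ballot_iff
proof (intro allI)
  fix k i
  have row: "{a \<in> {1..n - k}. row_of T a = i} = (\<lambda>j. T (i, j)) ` {j. j < f i \<and> T (i, j) \<le> n - k}" for i
  proof -
    have "{a \<in> {1..n - k}. row_of T a = i} = {a \<in> {a \<in> {1..n}. row_of T a = i}. a \<le> n - k}" by auto
    then show ?thesis unfolding row_eq_image by auto
  qed
  have c: "count_list (drop k (row_word T)) i = card {j. j < f i \<and> T (i, j) \<le> n - k}" for i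
    unfolding count_list_drop_row_word row
    by (rule card_image, rule inj_on_subset[OF row_inj]) auto
  have "{j. j < f (Suc i) \<and> T (Suc i, j) \<le> n - k} \<subseteq> {j. j < f i \<and> T (i, j) \<le> n - k}"
  proof clarify
    fix j assume j: "j < f (Suc i)" "T (Suc i, j) \<le> n - k"
    then show "j < f i \<and> T (i, j) \<le> n - k"
      using T_col[of i "Suc i" j] f_antimono[of i "Suc i"] by simp
  qed
  then show "count_list (drop k (row_word T)) (Suc i) \<le> count_list (drop k (row_word T)) i"
    unfolding c by (intro card_mono) auto
qed

lemma row_word_in_ballot_words: "row_word T \<in> ballot_words f"
  by (simp add: ballot_words_def ballot_row_word count_list_row_word)

lemma mem_descent_set_iff:
  "a \<in> descent_set lam T \<longleftrightarrow> a \<in> {1..n - 1} \<and> row_of T a < row_of T (Suc a)"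
proof
  assume "a \<in> descent_set lam T"
  then obtain i j i' j' where *: "j < f i" "j' < f i'" "T (i, j) = a" "T (i', j') = Suc a" "i < i'"
    by (auto simp: descent_set_def diagram)
  then have "row_of T a = i" "row_of T (Suc a) = i'" using row_of_T by metis+
  moreover have "a \<in> {1..n}" "Suc a \<in> {1..n}" using * T_in_range by metis+
  ultimately show "a \<in> {1..n - 1} \<and> row_of T a < row_of T (Suc a)" using * by auto
next
  assume *: "a \<in> {1..n - 1} \<and> row_of T a < row_of T (Suc a)"
  then have "a \<in> {1..n}" "Suc a \<in> {1..n}" by auto
  from T_surj[OF this(1)] T_surj[OF this(2)] * show "a \<in> descent_set lam T"
    unfolding descent_set_def diagram by auto
qed

text \<open>Position \<open>k\<close> of the word compares the entries \<open>n - k\<close> and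
  \<open>a = n - Suc k\<close>, and \<open>k\<close> is odd exactly when \<open>n + a\<close> is
  even.\<close>

lemma zigzag_row_word_iff:
  "zigzag (row_word T) \<longleftrightarrow> descent_set lam T = {a. even (n + a)} \<inter> {1..n - 1}"
proof -
  have "zigzag (row_word T) \<longleftrightarrow> (\<forall>k. Suc k < n \<longrightarrow> (row_of T (n - Suc k) < row_of T (n - k) \<longleftrightarrow> odd k))"
    unfolding zigzag_iff by (auto simp: nth_row_word)
  also have "\<dots> \<longleftrightarrow> (\<forall>a. a \<in> {1..n - 1} \<longrightarrow> (row_of T a < row_of T (Suc a) \<longleftrightarrow> even (n + a)))"
    (is "(\<forall>k. ?P k) \<longleftrightarrow> (\<forall>a. ?Q a)")
  proof
    assume P: "\<forall>k. ?P k"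
    show "\<forall>a. ?Q a"
    proof (intro allI impI)
      fix a assume a: "a \<in> {1..n - 1}"
      then have "Suc (n - Suc a) < n" "n - Suc (n - Suc a) = a" "n - (n - Suc a) = Suc a"
        "odd (n - Suc a) \<longleftrightarrow> even (n + a)" by auto
      then show "row_of T a < row_of T (Suc a) \<longleftrightarrow> even (n + a)"
        using P[rule_format, of "n - Suc a"] by simp
    qed
  next
    assume Q: "\<forall>a. ?Q a"
    show "\<forall>k. ?P k"
    proof (intro allI impI)
      fix k assume k: "Suc k < n"
      then have "n - Suc k \<in> {1..n - 1}" "Suc (n - Suc k) = n - k" "even (n + (n - Suc k)) \<longleftrightarrow> odd k" by auto
      then show "row_of T (n - Suc k) < row_of T (n - k) \<longleftrightarrow> odd k"
        using Q[rule_format, of "n - Suc k"] by simp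
    qed
  qed
  also have "\<dots> \<longleftrightarrow> descent_set lam T = {a. even (n + a)} \<inter> {1..n - 1}"
    unfolding set_eq_iff using mem_descent_set_iff by auto
  finally show ?thesis .
qed

end

text \<open>The word fixes the set of entries of each row, and these must increase along the
  row.\<close>

lemma inj_on_row_word: "inj_on row_word (standard_tableaux lam)"
proof (rule inj_onI)
  fix T T' assume T: "T \<in> standard_tableaux lam" and T': "T' \<in> standard_tableaux lam"
    and eq: "row_word T = row_word T'"
  have "row_of T a = row_of T' a" if "a \<in> {1..n}" for a
    using nth_row_word[of "n - a" T] nth_row_word[of "n - a" T'] that eq by simp
  then have "{a \<in> {1..n}. row_of T a = i} = {a \<in> {1..n}. row_of T' a = i}" for i by auto
  then have im: "(\<lambda>j. T (i, j)) ` {..<f i} = (\<lambda>j. T' (i, j)) ` {..<f i}" for i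
    unfolding row_eq_image[OF T] row_eq_image[OF T'] .
  show "T = T'"
  proof
    fix c :: "nat \<times> nat"
    obtain i j where c: "c = (i, j)" by fastforce
    show "T c = T' c"
    proof (cases "c \<in> Y")
      case True
      then show ?thesis
        unfolding c by (intro strict_mono_on_image_eq_imp_eq[OF _ _ im[of i]])
          (auto intro: T_row[OF T] T_row[OF T'] simp: diagram)
    next
      case False
      moreover have "T \<in> extensional Y" "T' \<in> extensional Y"
        using T T' by (simp_all only: standard_tableaux_def mem_Collect_eq)
      ultimately show ?thesis by (metis extensional_arb)
    qed
  qed
qed

text \<open>Row \<open>i\<close> receives, in increasing order, the entries whose letter is
  \<open>i\<close>; the ballot condition makes the columns increase.\<close>

lemma row_word_surj:
  assumes w: "w \<in> ballot_words f"
  shows "\<exists>T\<in>standard_tableaux lam. row_word T = w"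
proof -
  have len: "length w = n" using ballot_words_length(2)[OF w partition] unfolding size .
  have cnt: "count_list w = f" and bal: "ballot w" using w by (auto simp: ballot_words_def)
  define S where "S i = {a \<in> {1..n}. w ! (n - a) = i}" for i
  have finS: "finite (S i)" for i by (simp add: S_def)
  have count_drop: "count_list (drop k w) i = card {a \<in> S i. a \<le> n - k}" if "k \<le> n" for k i
  proof -
    have "count_list (drop k w) i = card {q. q < n - k \<and> w ! (k + q) = i}"
      unfolding count_list_eq_length_filter length_filter_conv_card
      using that by (simp add: len eq_commute[of i])
    \<comment> \<open>Position \<open>k + q\<close> of the word carries the entry
      \<open>n - k - q\<close>.\<close>
    also have "\<dots> = card {a \<in> S i. a \<le> n - k}"
      by (rule bij_betw_same_card[of "\<lambda>q. n - k - q"],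
          rule bij_betw_byWitness[where f' = "\<lambda>a. n - k - a"]) (use that in \<open>auto simp: S_def\<close>)
    finally show ?thesis .
  qed
  have cardS: "card (S i) = f i" for i
  proof -
    have "{a \<in> S i. a \<le> n} = S i" by (auto simp: S_def)
    then show ?thesis using count_drop[of 0 i] cnt by simp
  qed
  define l where "l i = sorted_list_of_set (S i)" for i
  have len_l: "length (l i) = f i" and set_l: "set (l i) = S i" for i
    using finS by (simp_all add: l_def cardS)
  define T where "T = restrict (\<lambda>(i, j). l i ! j) Y"
  have T_eq: "T (i, j) = l i ! j" if "j < f i" for i j
    using that by (simp add: T_def diagram)
  have T_mem: "T (i, j) \<in> S i" if "j < f i" for i j
    using that len_l[of i] set_l[of i] nth_mem[of j "l i"] by (simp add: T_eq)
  have row: "T (i, j) < T (i, j')" if "j < j'" "j' < f i" for i j j'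
  proof -
    have "sorted_wrt (<) (l i)" by (simp add: l_def)
    then show ?thesis using that len_l[of i] by (simp add: T_eq sorted_wrt_iff_nth_less)
  qed
  have step: "T (i, j) < T (Suc i, j)" if j: "j < f (Suc i)" for i j
  proof -
    let ?b = "T (Suc i, j)"
    have ji: "j < f i" using j f_antimono[of i "Suc i"] by simp
    have b: "?b \<in> S (Suc i)" using T_mem[OF j] .
    then have bn: "?b \<le> n" by (simp add: S_def)
    \<comment> \<open>Row \<open>Suc i\<close> has more than \<open>j\<close> entries up to
      \<open>?b\<close>; by the ballot condition on the suffix of length \<open>?b\<close> so has
      row \<open>i\<close>, hence its entry at index \<open>j\<close> is at most \<open>?b\<close>.
      Rows share no entry, so the inequality is strict.\<close>
    have "j < card {a \<in> S (Suc i). a \<le> ?b}"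
      using card_le_sorted_list_of_set_nth[OF finS, of j "Suc i"] j by (simp add: T_eq l_def cardS)
    also have "\<dots> \<le> card {a \<in> S i. a \<le> ?b}"
      using bal count_drop[of "n - ?b"] bn unfolding ballot_iff by (metis diff_diff_cancel diff_le_self)
    finally have "T (i, j) \<le> ?b"
      using sorted_list_of_set_nth_le[OF finS] ji by (simp add: T_eq l_def)
    moreover have "T (i, j) \<noteq> ?b" using T_mem[OF ji] b by (auto simp: S_def)
    ultimately show ?thesis by simp
  qed
  have col: "T (i, j) < T (i', j)" if "i < i'" "j < f i'" for i i' j
    using that
  proof (induction i')
    case (Suc i')
    have "j < f i'" using Suc.prems f_antimono[of i' "Suc i'"] by simp
    then show ?case using Suc step[of j i'] by (cases "i = i'") auto
  qed simp
  have bij: "bij_betw T Y {1..n}"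
    unfolding bij_betw_def
  proof
    show "inj_on T Y"
    proof (rule inj_onI, clarify)
      fix i j i' j' assume Y: "(i, j) \<in> Y" "(i', j') \<in> Y" and eq: "T (i, j) = T (i', j')"
      then have "i = i'" using T_mem[of j i] T_mem[of j' i'] by (auto simp: S_def diagram)
      moreover have "j = j'" using Y eq row[of j j' i] row[of j' j i] \<open>i = i'\<close>
        by (cases j j' rule: linorder_cases) (auto simp: diagram)
      ultimately show "i = i' \<and> j = j'" by simp
    qed
    show "T ` Y = {1..n}"
    proof
      show "T ` Y \<subseteq> {1..n}" using T_mem by (force simp: diagram S_def)
      show "{1..n} \<subseteq> T ` Y"
      proof
        fix a assume "a \<in> {1..n}"
        then have "a \<in> set (l (w ! (n - a)))" by (simp add: set_l S_def)
        then obtain j where "j < f (w ! (n - a))" "l (w ! (n - a)) ! j = a"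
          by (auto simp: in_set_conv_nth len_l)
        then show "a \<in> T ` Y"
          by (intro image_eqI[of _ _ "(w ! (n - a), j)"]) (auto simp: T_eq diagram)
      qed
    qed
  qed
  have "T \<in> extensional Y" by (simp add: T_def)
  then have T: "T \<in> standard_tableaux lam"
    unfolding standard_tableaux_def using bij row col unfolding diagram by blast
  have "row_word T = w"
  proof (rule nth_equalityI)
    fix k assume "k < length (row_word T)"
    then have k: "k < n" by simp
    then have "n - k \<in> {1..n}" by auto
    from T_surj[OF T this] obtain j where "j < f (row_of T (n - k))" "T (row_of T (n - k), j) = n - k" by auto
    then have "n - k \<in> S (row_of T (n - k))" using T_mem by metis
    then show "row_word T ! k = w ! k" using k by (simp add: S_def nth_row_word)
  qed (simp add: len)
  with T show ?thesis by blast
qed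

lemma card_zigzag_tableaux:
  "card {T \<in> standard_tableaux lam. descent_set lam T = {a. even (n + a)} \<inter> {1..n - 1}} =
   card {w \<in> ballot_words f. zigzag w}"
proof (rule bij_betw_same_card[of row_word])
  have "row_word ` {T \<in> standard_tableaux lam. descent_set lam T = {a. even (n + a)} \<inter> {1..n - 1}} =
     {w \<in> ballot_words f. zigzag w}"
  proof (intro subset_antisym subsetI)
    fix w assume "w \<in> {w \<in> ballot_words f. zigzag w}"
    then obtain T where T: "T \<in> standard_tableaux lam" "row_word T = w" "zigzag w"
      using row_word_surj by blast
    then have "descent_set lam T = {a. even (n + a)} \<inter> {1..n - 1}"
      by (simp only: zigzag_row_word_iff[symmetric])
    with T show "w \<in> row_word ` {T \<in> standard_tableaux lam. descent_set lam T = {a. even (n + a)} \<inter> {1..n - 1}}"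
      by (intro image_eqI[of _ _ T]) blast+
  next
    fix w assume "w \<in> row_word ` {T \<in> standard_tableaux lam. descent_set lam T = {a. even (n + a)} \<inter> {1..n - 1}}"
    then show "w \<in> {w \<in> ballot_words f. zigzag w}"
      using row_word_in_ballot_words zigzag_row_word_iff by fast
  qed
  then show "bij_betw row_word {T \<in> standard_tableaux lam. descent_set lam T = {a. even (n + a)} \<inter> {1..n - 1}}
     {w \<in> ballot_words f. zigzag w}"
    using inj_on_subset[OF inj_on_row_word] by (auto simp: bij_betw_def)
qed

end

section \<open>Staircase tableaux\<close>

lemma young_diagram_staircase: "young_diagram (staircase m) = {(i, j). j < m - 1 - i}"
  by (auto simp: young_diagram_def staircase_def rev_nth)

lemma young_diagram_staircase': "young_diagram (staircase m) = {(i, j). i + j < m - 1}"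
  by (auto simp: young_diagram_staircase)

lemma sum_list_staircase: "sum_list (staircase m) = (\<Sum>i<m - 1. m - 1 - i)"
proof -
  have "sum_list (staircase m) = (\<Sum>i=1..<m. i)"
    using interv_sum_list_conv_sum_set_nat[of "\<lambda>x. x" 1 m] by (simp add: staircase_def)
  also have "\<dots> = (\<Sum>i<m - 1. m - 1 - i)"
    by (rule sum.reindex_bij_witness[where i = "\<lambda>i. m - 1 - i" and j = "\<lambda>i. m - 1 - i"]) auto
  finally show ?thesis .
qed

lemma partition_shape_staircase: "partition_shape (staircase m) (\<lambda>i. m - 1 - i) (m - 1)"
  using staircase_fun_partitions_upto[of "m - 1"]
  by unfold_locales (auto simp: young_diagram_staircase sum_list_staircase)

section \<open>Transposition of staircase tableaux\<close>

definition transpose_tableau :: "(nat \<times> nat \<Rightarrow> nat) \<Rightarrow> nat \<times> nat \<Rightarrow> nat" where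
  "transpose_tableau T = (\<lambda>(i, j). T (j, i))"

lemma transpose_tableau_involutive [simp]: "transpose_tableau (transpose_tableau T) = T"
  by (auto simp: transpose_tableau_def)

lemma transpose_tableau_standard:
  assumes "T \<in> standard_tableaux (staircase m)"
  shows "transpose_tableau T \<in> standard_tableaux (staircase m)"
proof -
  let ?Y = "young_diagram (staircase m)"
  have "bij_betw (\<lambda>(i, j). (j, i)) ?Y ?Y"
    by (rule bij_betw_byWitness[where f' = "\<lambda>(i, j). (j, i)"]) (auto simp: young_diagram_staircase')
  then have "bij_betw (T \<circ> (\<lambda>(i, j). (j, i))) ?Y {1..sum_list (staircase m)}"
    by (rule bij_betw_trans) (use assms in \<open>simp add: standard_tableaux_def\<close>)
  moreover have "T \<circ> (\<lambda>(i, j). (j, i)) = transpose_tableau T"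
    by (auto simp: transpose_tableau_def)
  ultimately show ?thesis
    using assms by (auto simp: standard_tableaux_def young_diagram_staircase' transpose_tableau_def
        extensional_def add.commute)
qed

text \<open>Of two consecutive entries the larger lies either in a lower row or in a column further
  right, never both; transposition exchanges the two cases.\<close>

lemma descent_set_transpose_tableau:
  assumes T: "T \<in> standard_tableaux (staircase m)"
  shows "descent_set (staircase m) (transpose_tableau T) = {1..sum_list (staircase m) - 1} - descent_set (staircase m) T"
proof -
  let ?Y = "young_diagram (staircase m)" and ?n = "sum_list (staircase m)"
  have bij: "bij_betw T ?Y {1..?n}" using T by (simp add: standard_tableaux_def)
  have row: "T (i, j) < T (i, j')" if "(i, j') \<in> ?Y" "j < j'" for i j j'
    using T that unfolding standard_tableaux_def young_diagram_staircase' by auto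
  have col: "T (i, j) < T (i', j)" if "(i', j) \<in> ?Y" "i < i'" for i i' j
    using T that unfolding standard_tableaux_def young_diagram_staircase' by auto
  \<comment> \<open>If the larger entry were lower and further right, the cell
    \<open>(i, j')\<close> would hold an entry strictly between the two; if it were neither, it
    could not exceed the smaller one.\<close>
  have excl: "i < i' \<longleftrightarrow> \<not> j < j'"
    if c: "(i, j) \<in> ?Y" "(i', j') \<in> ?Y" "T (i', j') = Suc (T (i, j))" for i j i' j'
  proof
    assume "i < i'"
    show "\<not> j < j'"
    proof
      assume "j < j'"
      have d: "(i, j') \<in> ?Y" using c \<open>i < i'\<close> by (auto simp: young_diagram_staircase')
      then show False
        using row[OF d \<open>j < j'\<close>] col[OF c(2) \<open>i < i'\<close>] c(3) by simp
    qed
  next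
    assume "\<not> j < j'"
    show "i < i'"
    proof (rule ccontr)
      assume "\<not> i < i'"
      have d: "(i, j') \<in> ?Y" using c \<open>\<not> j < j'\<close> by (auto simp: young_diagram_staircase')
      have "T (i', j') \<le> T (i, j')"
        using col[OF d, of i'] \<open>\<not> i < i'\<close> by (cases "i = i'") auto
      moreover have "T (i, j') \<le> T (i, j)"
        using row[OF c(1), of j'] \<open>\<not> j < j'\<close> by (cases "j = j'") auto
      ultimately show False using c(3) by simp
    qed
  qed
  have mem: "a \<in> descent_set (staircase m) T \<longleftrightarrow> i < i'" "a \<in> descent_set (staircase m) (transpose_tableau T) \<longleftrightarrow> j < j'"
    if "(i, j) \<in> ?Y" "(i', j') \<in> ?Y" "T (i, j) = a" "T (i', j') = Suc a" for a i j i' j'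
  proof -
    have inj: "c = c'" if "c \<in> ?Y" "c' \<in> ?Y" "T c = T c'" for c c'
      using bij that by (auto simp: bij_betw_def dest: inj_onD)
    show "a \<in> descent_set (staircase m) T \<longleftrightarrow> i < i'"
    proof
      assume "a \<in> descent_set (staircase m) T"
      then obtain p q p' q' where "(p, q) \<in> ?Y" "(p', q') \<in> ?Y" "T (p, q) = a" "T (p', q') = Suc a" "p < p'"
        by (auto simp: descent_set_def)
      then show "i < i'" using inj[of "(p, q)" "(i, j)"] inj[of "(p', q')" "(i', j')"] that by simp
    qed (use that in \<open>auto simp: descent_set_def\<close>)
    show "a \<in> descent_set (staircase m) (transpose_tableau T) \<longleftrightarrow> j < j'"
    proof
      assume "a \<in> descent_set (staircase m) (transpose_tableau T)"
      then obtain p q p' q' where "(q, p) \<in> ?Y" "(q', p') \<in> ?Y" "T (p, q) = a" "T (p', q') = Suc a" "q < q'"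
        by (auto simp: descent_set_def transpose_tableau_def)
      moreover from this have "(p, q) \<in> ?Y" "(p', q') \<in> ?Y" by (auto simp: young_diagram_staircase')
      ultimately show "j < j'" using inj[of "(p, q)" "(i, j)"] inj[of "(p', q')" "(i', j')"] that by simp
    next
      assume "j < j'"
      moreover have "(j, i) \<in> ?Y" "(j', i') \<in> ?Y" using that by (auto simp: young_diagram_staircase')
      ultimately show "a \<in> descent_set (staircase m) (transpose_tableau T)"
        using that by (force simp: descent_set_def transpose_tableau_def)
    qed
  qed
  have range: "a \<in> {1..?n - 1}" if a: "a \<in> descent_set (staircase m) U" and U: "U \<in> standard_tableaux (staircase m)" for a U
  proof -
    obtain i j i' j' where "(i, j) \<in> ?Y" "(i', j') \<in> ?Y" "U (i, j) = a" "U (i', j') = Suc a"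
      using a unfolding descent_set_def by auto
    moreover have "U ` ?Y = {1..?n}" using U by (simp add: standard_tableaux_def bij_betw_def)
    ultimately have "a \<in> {1..?n}" "Suc a \<in> {1..?n}" by (metis imageI)+
    then show ?thesis by auto
  qed
  show ?thesis
  proof (rule Set.set_eqI)
    fix a
    show "a \<in> descent_set (staircase m) (transpose_tableau T) \<longleftrightarrow> a \<in> {1..?n - 1} - descent_set (staircase m) T"
    proof (cases "a \<in> {1..?n - 1}")
      case True
      then have "a \<in> T ` ?Y" "Suc a \<in> T ` ?Y" using bij by (auto simp: bij_betw_def)
      then obtain i j i' j' where c: "(i, j) \<in> ?Y" "(i', j') \<in> ?Y" "T (i, j) = a" "T (i', j') = Suc a"
        by (elim imageE) (metis surj_pair)
      show ?thesis using mem[OF c] excl[OF c(1,2)] c(3,4) True by auto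
    next
      case False
      then show ?thesis using range[OF _ transpose_tableau_standard[OF T]] by blast
    qed
  qed
qed

lemma alt_staircase_eq_ralt: "alt (staircase m) = ralt (staircase m)"
  unfolding alt_def ralt_def alternating_def reverse_alternating_def
proof (rule bij_betw_same_card[of transpose_tableau],
    rule bij_betw_byWitness[where f' = transpose_tableau])
  let ?I = "{1..sum_list (staircase m) - 1}"
  have compl: "?I - {a. odd a} \<inter> ?I = {a. even a} \<inter> ?I" "?I - {a. even a} \<inter> ?I = {a. odd a} \<inter> ?I"
    by blast+
  have step: "transpose_tableau T \<in> {T \<in> standard_tableaux (staircase m). descent_set (staircase m) T = ?I - B}"
    if "T \<in> {T \<in> standard_tableaux (staircase m). descent_set (staircase m) T = B}" for T B
    using that transpose_tableau_standard descent_set_transpose_tableau by simp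
  show "transpose_tableau ` {T \<in> standard_tableaux (staircase m). descent_set (staircase m) T = {a. odd a} \<inter> ?I} \<subseteq>
      {T \<in> standard_tableaux (staircase m). descent_set (staircase m) T = {a. even a} \<inter> ?I}"
    by (rule image_subsetI, drule step) (simp only: compl)
  show "transpose_tableau ` {T \<in> standard_tableaux (staircase m). descent_set (staircase m) T = {a. even a} \<inter> ?I} \<subseteq>
      {T \<in> standard_tableaux (staircase m). descent_set (staircase m) T = {a. odd a} \<inter> ?I}"
    by (rule image_subsetI, drule step) (simp only: compl)
qed simp_all

text \<open>Zigzag words have their descents at the \<open>a\<close> with the parity of the size:
  they count \<open>ralt\<close> for even and \<open>alt\<close> for odd size, and the two
  agree.\<close>

lemma ralt_staircase_eq_card_zigzag:
  "ralt (staircase m) = card {w \<in> ballot_words (\<lambda>i. m - 1 - i). zigzag w}"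
proof -
  interpret partition_shape "staircase m" "\<lambda>i. m - 1 - i" "m - 1" by (rule partition_shape_staircase)
  have "ralt (staircase m) = card {T \<in> standard_tableaux (staircase m). descent_set (staircase m) T = {a. even (sum_list (staircase m) + a)} \<inter> {1..sum_list (staircase m) - 1}}"
  proof (cases "even (sum_list (staircase m))")
    case True
    then show ?thesis by (simp add: ralt_def reverse_alternating_def)
  next
    case False
    then show ?thesis by (simp add: alternating_def alt_def flip: alt_staircase_eq_ralt)
  qed
  then show ?thesis by (simp only: card_zigzag_tableaux)
qed

section \<open>Hook lengths and the final count\<close>

lemma card_hook_staircase:
  assumes "i + j < m - 1"
  shows "card (hook (staircase m) (i, j)) = 2 * (m - 1 - i - j) - 1"
proof -
  have "hook (staircase m) (i, j) = {i} \<times> {j..<m - 1 - i} \<union> {Suc i..<m - 1 - j} \<times> {j}"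
    by (auto simp: hook_def young_diagram_staircase')
  moreover have "card \<dots> = card ({i} \<times> {j..<m - 1 - i}) + card ({Suc i..<m - 1 - j} \<times> {j})"
    by (rule card_Un_disjoint) auto
  ultimately show ?thesis using assms by simp
qed

text \<open>Row \<open>i\<close> has the hook lengths \<open>1, 3, ..., 2 * (m - 1 - i) - 1\<close>;
  the induction regroups them by value.\<close>

lemma hook_product_staircase: "hook_product (staircase m) = odd_hook_product (m - 1)"
proof -
  let ?W = "\<lambda>k. \<Prod>s<k. 2 * s + (1::nat)"
  have W: "(\<Prod>j<N. ?W (N - j)) = odd_hook_product N" for N
  proof (induction N)
    case 0
    show ?case by (simp add: odd_hook_product_def)
  next
    case (Suc N)
    have "(\<Prod>j<Suc N. ?W (Suc N - j)) = ?W (Suc N) * (\<Prod>j<N. ?W (N - j))"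
      by (subst prod.lessThan_Suc_shift) simp
    then show ?case unfolding Suc odd_hook_product_Suc by (simp only: mult.commute)
  qed
  have "young_diagram (staircase m) = Sigma {..<m - 1} (\<lambda>i. {..<m - 1 - i})"
    by (auto simp: young_diagram_staircase)
  then have "hook_product (staircase m) = (\<Prod>i<m - 1. \<Prod>j<m - 1 - i. card (hook (staircase m) (i, j)))"
    unfolding hook_product_def by (simp add: prod.Sigma)
  also have "\<dots> = (\<Prod>i<m - 1. ?W (m - 1 - i))"
  proof (rule prod.cong[OF refl])
    fix i assume "i \<in> {..<m - 1}"
    have "(\<Prod>j<m - 1 - i. card (hook (staircase m) (i, j))) = (\<Prod>j<m - 1 - i. 2 * (m - 1 - i - j) - 1)"
      by (intro prod.cong refl card_hook_staircase) auto
    also have "\<dots> = ?W (m - 1 - i)"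
      by (rule prod.reindex_bij_witness[where i = "\<lambda>s. m - 1 - i - 1 - s" and j = "\<lambda>s. m - 1 - i - 1 - s"]) auto
    finally show "(\<Prod>j<m - 1 - i. card (hook (staircase m) (i, j))) = ?W (m - 1 - i)" .
  qed
  finally show ?thesis by (simp only: W)
qed

text \<open>The signed count and the signed umbral value carry the same sign, given by half the
  number of cells, which cancels.\<close>

lemma ralt_staircase:
  assumes "m \<ge> 2"
  shows "real (ralt (staircase m)) =
     umbral_eval (umbral_E ^ (m div 2) *
       (\<Prod>d=1..m - 2. (umbral_E ^ 2 + [:(real d)\<^sup>2:]) ^ ((m - d) div 2)))
     / real (hook_product (staircase m))"
proof -
  define N where "N = m - 1"
  have m: "m = Suc N" "m - 2 = N - 1" "0 < N" using assms by (auto simp: N_def)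
  let ?n = "\<Sum>i<N. N - i" and ?h = "real (odd_hook_product N)"
  let ?u = "umbral_eval (umbral_E ^ (m div 2) *
       (\<Prod>d=1..m - 2. (umbral_E ^ 2 + [:(real d)\<^sup>2:]) ^ ((m - d) div 2)))"
  have "?h * ((-1) ^ (?n div 2) * real (ralt (staircase m))) = ?h * real_of_int (signed_zigzag_count N (staircase_fun N))"
    by (simp add: signed_zigzag_count_def ralt_staircase_eq_card_zigzag m)
  also have "\<dots> = signed_umbral_eval (content_poly N)"
    unfolding signed_zigzag_count_eq_umbral[OF staircase_fun_partitions_upto m(3)]
      signed_umbral_eval_smult[symmetric] jacobi_trudi_poly_staircase ..
  also have "\<dots> = (-1) ^ (?n div 2) * ?u"
    unfolding signed_umbral_eval_content_poly m(2) unfolding m(1) ..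
  finally have "?h * real (ralt (staircase m)) = ?u" by simp
  moreover have "?h \<noteq> 0" using jacobi_trudi_staircase_fps_exp[of N] by (metis mult_zero_right zero_neq_one)
  ultimately show ?thesis by (simp add: hook_product_staircase m field_simps)
qed

theorem theorem4p3:
  fixes m k :: nat
  assumes "m \<ge> 2"
  shows "hook_product (staircase m) = (\<Prod>i = 1..m - 1. (2 * i - 1) ^ (m - i)) \<and>
    (m = 2 * k \<longrightarrow>
      alt (staircase m) = ralt (staircase m) \<and>
      real (ralt (staircase m)) =
        umbral_eval (umbral_E ^ k *
          (\<Prod>j = 1..m - 2. (umbral_E ^ 2 + [:(real j)\<^sup>2:]) ^ (k - nat \<lceil>real j / 2\<rceil>)))
        / real (hook_product (staircase m))) \<and>
    (m = 2 * k + 1 \<longrightarrow>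
      alt (staircase m) = ralt (staircase m) \<and>
      real (ralt (staircase m)) =
        umbral_eval (umbral_E ^ k *
          (\<Prod>j = 1..m - 2. (umbral_E ^ 2 + [:(real j)\<^sup>2:]) ^ (k - nat \<lfloor>real j / 2\<rfloor>)))
        / real (hook_product (staircase m)))"
proof (intro conjI impI)
  show "hook_product (staircase m) = (\<Prod>i = 1..m - 1. (2 * i - 1) ^ (m - i))"
    using assms by (simp add: hook_product_staircase odd_hook_product_def)
next
  assume m: "m = 2 * k"
  \<comment> \<open>Rounding \<open>k - j / 2\<close> down amounts to rounding \<open>j / 2\<close>
    up; for odd \<open>m\<close> the extra half reverses this.\<close>
  have "(m - j) div 2 = k - nat \<lceil>real j / 2\<rceil>" for j
  proof -
    have "nat \<lceil>real j / 2\<rceil> = Suc j div 2" by linarith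
    then show ?thesis using m by simp
  qed
  moreover have "m div 2 = k" using m by simp
  ultimately show "real (ralt (staircase m)) =
        umbral_eval (umbral_E ^ k *
          (\<Prod>j = 1..m - 2. (umbral_E ^ 2 + [:(real j)\<^sup>2:]) ^ (k - nat \<lceil>real j / 2\<rceil>)))
        / real (hook_product (staircase m))"
    using ralt_staircase[OF assms] by (simp only:)
next
  assume m: "m = 2 * k + 1"
  have "(m - j) div 2 = k - nat \<lfloor>real j / 2\<rfloor>" for j
  proof -
    have "nat \<lfloor>real j / 2\<rfloor> = j div 2" by linarith
    then show ?thesis using m by simp
  qed
  moreover have "m div 2 = k" using m by simp
  ultimately show "real (ralt (staircase m)) =
        umbral_eval (umbral_E ^ k *
          (\<Prod>j = 1..m - 2. (umbral_E ^ 2 + [:(real j)\<^sup>2:]) ^ (k - nat \<lfloor>real j / 2\<rfloor>)))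
        / real (hook_product (staircase m))"
    using ralt_staircase[OF assms] by (simp only:)
qed (rule alt_staircase_eq_ralt)+

end
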